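(* Let $n\ge 2$, let $T$ be a tree on $n$ vertices, let $G$ be the complement graph of $T$, and let $J(G)\subset S=\mathsf{k}[X_1,\dots,X_n]$ be the cover ideal of $G$. Then for all $s\ge 1$ and $i\ge 0$, the Betti numbers of $J(G)^s$ are given by $$\beta_i^S(J(G)^s)=\binom{n-2}{i}\binom{n-2-i+s}{n-2}.$$
   Context: $\mathsf{k}$ is a field; graphs are finite and simple on the vertex set $[n]=\{1,\dots,n\}$. The complement graph $G^c$ of $G$ has the same vertices, and $\{i,j\}$ ($i\ne j$) is an edge of $G^c$ if and only if it is not an edge of $G$. A subset $C\subset[n]$ is a cover set of $G$ if it meets every edge of $G$; it is minimal if $C\setminus\{l\}$ is not a cover set for any $l\in C$. The cover ideal of $G$ is $J(G)=\langle\prod_{i\in C}X_i: C\text{ is a minimal cover set of }G\rangle\subset S$ (an empty product being $1$). $\beta_i^S(M)=\dim_{\mathsf{k}}\operatorname{Tor}_i^S(M,\mathsf{k})$ is the $i$-th (total) Betti number of $M$. The right-hand side is $0$ when $i>n-2$, since $\binom{n-2}{i}=0$. *)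

theory Defs
  imports
    "HOL-Library.Poly_Mapping"
    "Jordan_Normal_Form.Matrix_Kernel"
    "Jordan_Normal_Form.DL_Rank"
begin

section \<open>Graphs\<close>

text \<open>A graph on the vertex set \<open>UNIV :: 'v set\<close> is given by its set of edges.\<close>

type_synonym 'v graph = "'v set set"

definition simple_graph :: "'v graph \<Rightarrow> bool" where
  "simple_graph E \<longleftrightarrow> (\<forall>e\<in>E. card e = 2)"

definition graph_connected :: "'v graph \<Rightarrow> bool" where
  "graph_connected E \<longleftrightarrow> (\<forall>u v. (u, v) \<in> {(x, y). {x, y} \<in> E}\<^sup>*)"

definition graph_cycle :: "'v graph \<Rightarrow> 'v list \<Rightarrow> bool" where
  "graph_cycle E c \<longleftrightarrow> length c \<ge> 3 \<and> distinct c \<and>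
     (\<forall>j<length c. {c ! j, c ! (Suc j mod length c)} \<in> E)"

definition is_tree :: "'v graph \<Rightarrow> bool" where
  "is_tree E \<longleftrightarrow> simple_graph E \<and> graph_connected E \<and> (\<nexists>c. graph_cycle E c)"

definition complement_graph :: "'v graph \<Rightarrow> 'v graph" where
  "complement_graph E = {{i, j} | i j. i \<noteq> j \<and> {i, j} \<notin> E}"

definition cover_set :: "'v graph \<Rightarrow> 'v set \<Rightarrow> bool" where
  "cover_set E C \<longleftrightarrow> (\<forall>e\<in>E. C \<inter> e \<noteq> {})"

definition minimal_cover_set :: "'v graph \<Rightarrow> 'v set \<Rightarrow> bool" where
  "minimal_cover_set E C \<longleftrightarrow> cover_set E C \<and> (\<forall>l\<in>C. \<not> cover_set E (C - {l}))"


section \<open>Polynomials and ideals\<close>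

text \<open>The polynomial ring over \<open>'k\<close> in the variables indexed by \<open>'v\<close>: finitely supported
  functions from exponent vectors to coefficients, with convolution as product.\<close>

type_synonym ('v, 'k) mpoly = "('v \<Rightarrow>\<^sub>0 nat) \<Rightarrow>\<^sub>0 'k"

definition Var :: "'v \<Rightarrow> ('v, 'k::field) mpoly" where
  "Var i = Poly_Mapping.single (Poly_Mapping.single i 1) 1"

text \<open>Ideals of a commutative ring are the submodules of the ring over itself.\<close>

definition ideal_gen :: "'a::comm_ring_1 set \<Rightarrow> 'a set" where
  "ideal_gen B = Modules.module.span (*) B"

definition ideal_mult :: "'a::comm_ring_1 set \<Rightarrow> 'a set \<Rightarrow> 'a set" where
  "ideal_mult I J = ideal_gen {a * b | a b. a \<in> I \<and> b \<in> J}"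

primrec ideal_power :: "'a::comm_ring_1 set \<Rightarrow> nat \<Rightarrow> 'a set" where
  "ideal_power I 0 = UNIV"
| "ideal_power I (Suc s) = ideal_mult I (ideal_power I s)"

definition cover_ideal :: "'v graph \<Rightarrow> ('v, 'k::field) mpoly set" where
  "cover_ideal E = ideal_gen {(\<Prod>i\<in>C. Var i) | C. minimal_cover_set E C}"


section \<open>Betti numbers of ideals\<close>

text \<open>\<open>free_resolution I r d\<close>: with \<open>S = 'a\<close> and \<open>F\<^sub>i = S\<^bsup>r i\<^esup>\<close>, the sequence
  \<open>\<dots> \<rightarrow> F\<^sub>2 \<rightarrow> F\<^sub>1 \<rightarrow> F\<^sub>0 \<rightarrow> I \<rightarrow> 0\<close> of \<open>S\<close>-modules is exact. The matrix of \<open>F\<^sub>i\<^sub>+\<^sub>1 \<rightarrow> F\<^sub>i\<close> is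
  \<open>d (i + 1)\<close>, and \<open>d 0\<close>, with a single row, is the augmentation \<open>F\<^sub>0 \<rightarrow> I \<subseteq> S\<close>. Finite ranks
  suffice since the polynomial ring is Noetherian.\<close>

definition free_resolution ::
  "'a::comm_ring_1 set \<Rightarrow> (nat \<Rightarrow> nat) \<Rightarrow> (nat \<Rightarrow> 'a mat) \<Rightarrow> bool" where
  "free_resolution I r d \<longleftrightarrow>
     d 0 \<in> carrier_mat 1 (r 0) \<and>
     (\<forall>i. d (Suc i) \<in> carrier_mat (r i) (r (Suc i))) \<and>
     {(d 0 *\<^sub>v v) $ 0 | v. v \<in> carrier_vec (r 0)} = I \<and>
     (\<forall>i. mat_kernel (d i) = {d (Suc i) *\<^sub>v w | w. w \<in> carrier_vec (r (Suc i))})"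

text \<open>The evaluation at the origin, i.e. the quotient map \<open>S \<rightarrow> S/(X\<^sub>1, \<dots>, X\<^sub>n) = \<k>\<close> that makes
  the coefficient field an \<open>S\<close>-module.\<close>

definition residue :: "('v, 'k::field) mpoly \<Rightarrow> 'k" where
  "residue p = Poly_Mapping.lookup p 0"

text \<open>The dimension of \<open>H\<^sub>i(F \<otimes> \<k>)\<close>. Here \<open>F\<^sub>i \<otimes> \<k> = \<k>\<^bsup>r i\<^esup>\<close>, and the differentials are
  reduced entrywise. The complex \<open>F\<close> does not contain the augmentation, so the map out of
  \<open>F\<^sub>0 \<otimes> \<k>\<close> is zero. The truncated subtraction is exact because the image of one differential
  lies in the kernel of the next.\<close>

definition homology_dim ::
  "(nat \<Rightarrow> nat) \<Rightarrow> (nat \<Rightarrow> ('v, 'k::field) mpoly mat) \<Rightarrow> nat \<Rightarrow> nat" where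
  "homology_dim r d i =
     (if i = 0 then r 0 else kernel_dim (map_mat residue (d i)))
       - vec_space.rank (r i) (map_mat residue (d (Suc i)))"

text \<open>\<open>dim Tor\<^sub>i(I, \<k>)\<close>, computed from an arbitrarily chosen free resolution of \<open>I\<close>.\<close>

definition betti :: "('v, 'k::field) mpoly set \<Rightarrow> nat \<Rightarrow> nat" where
  "betti I i = (let (r, d) = SOME (r, d). free_resolution I r d in homology_dim r d i)"

end

theory Submission
  imports Defs
begin

text \<open>
  Why the formula holds. The cover sets of the complement of \<open>T\<close> are the complements of cliques of \<open>T\<close>, and the
  maximal cliques of a tree are its edges (\<open>minimal_cover_set_complement_tree\<close>). So \<open>J\<close> is generated by the
  \<open>n - 1\<close> monomials \<open>m\<^sub>e\<close>, the product of the variables outside the edge \<open>e\<close>. Order the vertices as \<open>x\<^sub>0, x\<^sub>1, \<dots>\<close>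
  such that each \<open>x\<^sub>j\<close> with \<open>j \<ge> 1\<close> has exactly one neighbour among the earlier ones (\<open>tree_leaf_order\<close>), and call the
  edge to it \<open>e\<^sub>j\<close>. For \<open>j \<ge> 2\<close> the edge \<open>e\<^sub>j\<close> is adjacent to an earlier edge \<open>e\<^sub>q\<close>, whose other end is called
  \<open>x\<^sub>w\<close>. Then \<open>X\<^sub>j m\<^sub>j = X\<^sub>w m\<^sub>q\<close>. This gives the \<open>n - 2\<close> elements \<open>f\<^sub>j = X\<^sub>j Y\<^sub>j - X\<^sub>w Y\<^sub>q\<close> of the kernel of the map from
  \<open>S[Y\<^sub>1, \<dots>, Y\<^sub>n\<^sub>-\<^sub>1]\<close> onto the Rees algebra of \<open>J\<close>.

  These elements form a regular sequence that generates the kernel. Neither \<open>X\<^sub>j\<close> nor \<open>Y\<^sub>j\<close> occurs in \<open>X\<^sub>w Y\<^sub>q\<close> or in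
  an earlier \<open>f\<^sub>u\<close>. Hence division by \<open>f\<^sub>j\<close> with leading monomial \<open>X\<^sub>j Y\<^sub>j\<close> is possible and linear
  over the earlier elements, which contracts the Koszul complex step by step (\<open>koszul_exact\<close>). Remainders
  are combinations of monomials divisible by no \<open>X\<^sub>j Y\<^sub>j\<close> with \<open>j \<ge> 2\<close>, and such monomials have distinct images, as
  one sees by removing leaves from the tree (\<open>normal_monomials_distinct\<close>); so nothing but the ideal of
  the \<open>f\<^sub>j\<close> maps to zero (\<open>augment_kernel\<close>).

  The part of degree \<open>s\<close> in \<open>Y\<close> of the Koszul complex is therefore a free resolution of \<open>J\<^sup>s\<close> over \<open>S\<close>. Its basis in
  homological degree \<open>i\<close> consists of an \<open>i\<close>-element subset of the \<open>n - 2\<close> relations together with a monomial of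
  degree \<open>s - i\<close> in \<open>n - 1\<close> variables, and its matrices have entries in the ideal of the variables
  (\<open>minimal_resolution\<close>, \<open>card_basis\<close>). Since Betti numbers are computed from an arbitrary resolution, the
  comparison theorem for resolutions (\<open>homology_of_reduced_resolution\<close>) identifies them with these ranks.
\<close>

section \<open>Comparison of free resolutions\<close>

lemma matrix_factors_through:
  fixes A C :: "'a::comm_ring_1 mat"
  assumes A: "A \<in> carrier_mat a b" and C: "C \<in> carrier_mat a c"
    and ex: "\<And>j. j < c \<Longrightarrow> \<exists>w\<in>carrier_vec b. A *\<^sub>v w = col C j"
  obtains B where "B \<in> carrier_mat b c" "A * B = C"
proof -
  obtain w where w: "\<And>j. j < c \<Longrightarrow> w j \<in> carrier_vec b \<and> A *\<^sub>v w j = col C j"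
    using ex by metis
  define B where "B = mat_of_cols b (map w [0..<c])"
  have B: "B \<in> carrier_mat b c" by (simp add: B_def mat_of_cols_def)
  have "A * B = C"
  proof (rule mat_col_eqI)
    fix j assume "j < dim_col C"
    then have j: "j < c" using C by simp
    have "col B j = w j" unfolding B_def using j w by (subst col_mat_of_cols) auto
    then show "col (A * B) j = col C j" using w j col_mult2[OF A B j] by simp
  qed (use A B C in auto)
  then show ?thesis using B that by blast
qed

lemma mult_mat_unit_vec:
  fixes A :: "'a::comm_ring_1 mat"
  assumes "A \<in> carrier_mat a b" "j < b"
  shows "A *\<^sub>v unit_vec b j = col A j"
  using col_mult2[OF assms(1) one_carrier_mat assms(2)] assms by simp

lemma minus_add_cancel_mat:
  fixes A B :: "'a::comm_ring_1 mat"
  assumes "A \<in> carrier_mat a b" "B \<in> carrier_mat a b"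
  shows "A - B + B = A"
  by (rule eq_matI) (use assms in auto)

lemma minus_minus_cancel_mat:
  fixes A B :: "'a::comm_ring_1 mat"
  assumes "A \<in> carrier_mat a b" "B \<in> carrier_mat a b"
  shows "A - (A - B) = B"
  by (rule eq_matI) (use assms in auto)

context
  fixes I :: "'a::comm_ring_1 set" and r :: "nat \<Rightarrow> nat" and d :: "nat \<Rightarrow> 'a mat"
  assumes res: "free_resolution I r d"
begin

lemma resolution_carrier: "d 0 \<in> carrier_mat 1 (r 0)" "d (Suc i) \<in> carrier_mat (r i) (r (Suc i))"
  using res by (auto simp: free_resolution_def)

lemma resolution_augmentation: "{(d 0 *\<^sub>v v) $ 0 | v. v \<in> carrier_vec (r 0)} = I"
  using res by (simp add: free_resolution_def)

lemma resolution_exact: "mat_kernel (d i) = {d (Suc i) *\<^sub>v w | w. w \<in> carrier_vec (r (Suc i))}"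
  using res by (simp add: free_resolution_def)

lemma resolution_carrier': "d i \<in> carrier_mat (case i of 0 \<Rightarrow> 1 | Suc j \<Rightarrow> r j) (r i)"
  using resolution_carrier by (cases i) auto

lemma resolution_complex: "d i * d (Suc i) = 0\<^sub>m (dim_row (d i)) (r (Suc i))"
proof (rule mat_col_eqI)
  fix j assume "j < dim_col (0\<^sub>m (dim_row (d i)) (r (Suc i)) :: 'a mat)"
  then have j: "j < r (Suc i)" by simp
  have "col (d (Suc i)) j = d (Suc i) *\<^sub>v unit_vec (r (Suc i)) j"
    using mult_mat_unit_vec[OF resolution_carrier(2) j] by simp
  then have "col (d (Suc i)) j \<in> mat_kernel (d i)"
    unfolding resolution_exact by (auto intro: unit_vec_carrier)
  then have "d i *\<^sub>v col (d (Suc i)) j = 0\<^sub>v (dim_row (d i))"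
    by (simp add: mat_kernel_def)
  then show "col (d i * d (Suc i)) j = col (0\<^sub>m (dim_row (d i)) (r (Suc i))) j"
    using col_mult2[OF resolution_carrier' resolution_carrier(2) j] j by simp
qed (use resolution_carrier(2)[of i] in auto)

text \<open>Exactness in matrix form: a matrix annihilated by one differential factors through the next. The
  inductive steps of the lifting arguments below reduce to this.\<close>

lemma resolution_lift:
  assumes C: "C \<in> carrier_mat (r i) c" and 0: "d i * C = 0\<^sub>m (dim_row (d i)) c"
  obtains B where "B \<in> carrier_mat (r (Suc i)) c" "d (Suc i) * B = C"
proof (rule matrix_factors_through[OF resolution_carrier(2) C])
  fix j assume j: "j < c"
  have "d i *\<^sub>v col C j = 0\<^sub>v (dim_row (d i))"
    using col_mult2[OF resolution_carrier' C j] 0 j by simp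
  moreover have "dim_col (d i) = r i" using resolution_carrier'[of i] by simp
  ultimately have "col C j \<in> mat_kernel (d i)"
    using C j unfolding mat_kernel_def by auto
  then show "\<exists>w\<in>carrier_vec (r (Suc i)). d (Suc i) *\<^sub>v w = col C j"
    unfolding resolution_exact by auto
qed (use that in auto)

end

text \<open>Free modules are projective, so the identity of \<open>I\<close> lifts degree by degree. The recursion needs,
  besides the matrix found so far, that its composite with the next differential of the source is
  a cycle of the target.\<close>

lemma resolution_chain_map:
  assumes F: "free_resolution I r d" and F': "free_resolution I r' d'"
  obtains f where "\<And>i. f i \<in> carrier_mat (r' i) (r i)" "d' 0 * f 0 = d 0"
    "\<And>i. d' (Suc i) * f (Suc i) = f i * d (Suc i)"
proof -
  note c = resolution_carrier[OF F] and c' = resolution_carrier[OF F']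
  define P where "P i g \<longleftrightarrow> g \<in> carrier_mat (r' i) (r i) \<and>
    d' i * (g * d (Suc i)) = 0\<^sub>m (dim_row (d' i)) (r (Suc i)) \<and> (i = 0 \<longrightarrow> d' 0 * g = d 0)" for i g
  have start: "\<exists>g. P 0 g"
  proof (rule matrix_factors_through[OF c'(1) c(1)])
    fix j assume j: "j < r 0"
    have "(d 0 *\<^sub>v unit_vec (r 0) j) $ 0 \<in> I"
      unfolding resolution_augmentation[OF F, symmetric] by auto
    then obtain w where w: "w \<in> carrier_vec (r' 0)" "(d' 0 *\<^sub>v w) $ 0 = (d 0 *\<^sub>v unit_vec (r 0) j) $ 0"
      unfolding resolution_augmentation[OF F', symmetric] by auto
    have "d' 0 *\<^sub>v w = d 0 *\<^sub>v unit_vec (r 0) j"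
      by (rule eq_vecI) (use c(1) c'(1) w in auto)
    also have "\<dots> = col (d 0) j" using mult_mat_unit_vec[OF c(1) j] .
    finally show "\<exists>w\<in>carrier_vec (r' 0). d' 0 *\<^sub>v w = col (d 0) j" using w by auto
  next
    fix B assume B: "B \<in> carrier_mat (r' 0) (r 0)" "d' 0 * B = d 0"
    have "d' 0 * (B * d (Suc 0)) = d 0 * d (Suc 0)"
      using assoc_mult_mat[OF c'(1) B(1) c(2)] B(2) by simp
    also have "\<dots> = 0\<^sub>m (dim_row (d' 0)) (r (Suc 0))"
      using resolution_complex[OF F, of 0] c(1) c'(1) by simp
    finally show ?thesis using B unfolding P_def by blast
  qed
  have step: "\<exists>g'. P (Suc i) g' \<and> d' (Suc i) * g' = g * d (Suc i)" if Pg: "P i g" for i g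
  proof -
    have g: "g \<in> carrier_mat (r' i) (r i)" using that by (simp add: P_def)
    have gd: "g * d (Suc i) \<in> carrier_mat (r' i) (r (Suc i))" by (rule mult_carrier_mat[OF g c(2)])
    obtain B where B: "B \<in> carrier_mat (r' (Suc i)) (r (Suc i))" "d' (Suc i) * B = g * d (Suc i)"
      by (rule resolution_lift[OF F' gd]) (use Pg in \<open>auto simp: P_def\<close>)
    have "d' (Suc i) * (B * d (Suc (Suc i))) = g * (d (Suc i) * d (Suc (Suc i)))"
      using assoc_mult_mat[OF c'(2) B(1) c(2)[of "Suc i"]] assoc_mult_mat[OF g c(2) c(2)] B(2) by simp
    also have "\<dots> = 0\<^sub>m (dim_row (d' (Suc i))) (r (Suc (Suc i)))"
      using resolution_complex[OF F, of "Suc i"] c(2)[of i] c'(2)[of i] g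
        right_mult_zero_mat[OF g, of "r (Suc (Suc i))"] by simp
    finally have "P (Suc i) B" using B(1) by (simp add: P_def)
    then show ?thesis using B(2) by blast
  qed
  have "\<exists>f. \<forall>i. P i (f i) \<and> d' (Suc i) * f (Suc i) = f i * d (Suc i)"
    by (rule dependent_nat_choice[of P "\<lambda>i g g'. d' (Suc i) * g' = g * d (Suc i)", OF start step])
  then obtain f where f: "\<And>i. P i (f i) \<and> d' (Suc i) * f (Suc i) = f i * d (Suc i)" by blast
  show ?thesis
    by (rule that[of f]) (use f in \<open>simp_all add: P_def\<close>)
qed

text \<open>A chain endomorphism that lifts the zero map of \<open>I\<close> is null-homotopic, by the same degreewise
  lifting: \<open>u\<^sub>i\<^sub>+\<^sub>1 - h\<^sub>i d\<^sub>i\<^sub>+\<^sub>1\<close> consists of cycles because \<open>(u\<^sub>i - d\<^sub>i\<^sub>+\<^sub>1 h\<^sub>i) d\<^sub>i\<^sub>+\<^sub>1 = 0\<close>, so that \<open>h\<^sub>i\<^sub>+\<^sub>1\<close> exists.\<close>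

lemma resolution_null_homotopy:
  assumes F: "free_resolution I r d"
    and u: "\<And>i. u i \<in> carrier_mat (r i) (r i)"
    and u0: "d 0 * u 0 = 0\<^sub>m 1 (r 0)"
    and chain: "\<And>i. d (Suc i) * u (Suc i) = u i * d (Suc i)"
  obtains h where "\<And>i. h i \<in> carrier_mat (r (Suc i)) (r i)" "u 0 = d (Suc 0) * h 0"
    "\<And>i. u (Suc i) = d (Suc (Suc i)) * h (Suc i) + h i * d (Suc i)"
proof -
  note c = resolution_carrier[OF F]
  define P where "P i g \<longleftrightarrow> g \<in> carrier_mat (r (Suc i)) (r i) \<and>
    (u i - d (Suc i) * g) * d (Suc i) = 0\<^sub>m (r i) (r (Suc i)) \<and> (i = 0 \<longrightarrow> u 0 = d (Suc 0) * g)" for i g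
  have start: "\<exists>g. P 0 g"
  proof -
    obtain B where B: "B \<in> carrier_mat (r (Suc 0)) (r 0)" "d (Suc 0) * B = u 0"
      by (rule resolution_lift[OF F u[of 0]]) (use u0 c(1) in auto)
    have "u 0 - d (Suc 0) * B = 0\<^sub>m (r 0) (r 0)" unfolding B(2) by (rule minus_r_inv_mat[OF u])
    then have "P 0 B" using B left_mult_zero_mat[OF c(2)[of 0], of "r 0"] by (simp add: P_def)
    then show ?thesis by blast
  qed
  have step: "\<exists>g'. P (Suc i) g' \<and> u (Suc i) - g * d (Suc i) = d (Suc (Suc i)) * g'"
    if Pg: "P i g" for i g
  proof -
    have g: "g \<in> carrier_mat (r (Suc i)) (r i)" using that by (simp add: P_def)
    have gd: "g * d (Suc i) \<in> carrier_mat (r (Suc i)) (r (Suc i))" by (rule mult_carrier_mat[OF g c(2)])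
    have dg: "d (Suc i) * g \<in> carrier_mat (r i) (r i)" by (rule mult_carrier_mat[OF c(2) g])
    have C: "u (Suc i) - g * d (Suc i) \<in> carrier_mat (r (Suc i)) (r (Suc i))" by (rule minus_carrier_mat[OF gd])
    have "d (Suc i) * (u (Suc i) - g * d (Suc i)) = u i * d (Suc i) - (d (Suc i) * g) * d (Suc i)"
      using mult_minus_distrib_mat[OF c(2) u gd] chain assoc_mult_mat[OF c(2) g c(2)] by simp
    also have "\<dots> = (u i - d (Suc i) * g) * d (Suc i)"
      using minus_mult_distrib_mat[OF u dg c(2)] by simp
    finally have "d (Suc i) * (u (Suc i) - g * d (Suc i)) = 0\<^sub>m (dim_row (d (Suc i))) (r (Suc i))"
      using that c(2)[of i] by (simp add: P_def)
    then obtain B where B: "B \<in> carrier_mat (r (Suc (Suc i))) (r (Suc i))"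
      "d (Suc (Suc i)) * B = u (Suc i) - g * d (Suc i)"
      by (rule resolution_lift[OF F C])
    have "u (Suc i) - d (Suc (Suc i)) * B = g * d (Suc i)"
      unfolding B(2) by (rule minus_minus_cancel_mat[OF u gd])
    moreover have "g * d (Suc i) * d (Suc (Suc i)) = 0\<^sub>m (r (Suc i)) (r (Suc (Suc i)))"
      using assoc_mult_mat[OF g c(2) c(2)] resolution_complex[OF F, of "Suc i"] g c(2)[of i] by simp
    ultimately have "P (Suc i) B" using B(1) by (simp add: P_def)
    then show ?thesis using B(2)[symmetric] by blast
  qed
  have "\<exists>h. \<forall>i. P i (h i) \<and> u (Suc i) - h i * d (Suc i) = d (Suc (Suc i)) * h (Suc i)"
    by (rule dependent_nat_choice[of P "\<lambda>i g g'. u (Suc i) - g * d (Suc i) = d (Suc (Suc i)) * g'",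
        OF start step])
  then obtain h where h: "\<And>i. P i (h i) \<and> u (Suc i) - h i * d (Suc i) = d (Suc (Suc i)) * h (Suc i)"
    by blast
  have hc: "h i \<in> carrier_mat (r (Suc i)) (r i)" for i using h by (simp add: P_def)
  show ?thesis
  proof (rule that[of h])
    fix i
    have hd: "h i * d (Suc i) \<in> carrier_mat (r (Suc i)) (r (Suc i))"
      by (rule mult_carrier_mat[OF hc c(2)])
    have hS: "u (Suc i) - h i * d (Suc i) = d (Suc (Suc i)) * h (Suc i)" using h by blast
    show "u (Suc i) = d (Suc (Suc i)) * h (Suc i) + h i * d (Suc i)"
      using minus_add_cancel_mat[OF u hd] unfolding hS by (rule sym)
  next
    have "P 0 (h 0)" using h by blast
    then show "u 0 = d (Suc 0) * h 0" by (simp only: P_def)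
  qed (rule hc)
qed

lemma resolution_homotopy:
  assumes F: "free_resolution I r d" 
    and \<phi>: "\<And>i. \<phi> i \<in> carrier_mat (r i) (r i)" "d 0 * \<phi> 0 = d 0"
      "\<And>i. d (Suc i) * \<phi> (Suc i) = \<phi> i * d (Suc i)"
  obtains h where "\<And>i. h i \<in> carrier_mat (r (Suc i)) (r i)"
    "\<phi> 0 = 1\<^sub>m (r 0) + d (Suc 0) * h 0"
    "\<And>i. \<phi> (Suc i) = 1\<^sub>m (r (Suc i)) + (d (Suc (Suc i)) * h (Suc i) + h i * d (Suc i))"
proof -
  note c = resolution_carrier[OF F]
  define u where "u i = \<phi> i - 1\<^sub>m (r i)" for i
  have u: "u i \<in> carrier_mat (r i) (r i)" for i
    unfolding u_def by (rule minus_carrier_mat) simp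
  have \<phi>u: "\<phi> i = 1\<^sub>m (r i) + u i" for i
    unfolding u_def by (rule eq_matI) (use \<phi>(1)[of i] in auto)
  have u0: "d 0 * u 0 = 0\<^sub>m 1 (r 0)"
    unfolding u_def mult_minus_distrib_mat[OF c(1) \<phi>(1) one_carrier_mat] \<phi>(2)
    using c(1) by simp
  have chain: "d (Suc i) * u (Suc i) = u i * d (Suc i)" for i
    unfolding u_def mult_minus_distrib_mat[OF c(2) \<phi>(1) one_carrier_mat]
      minus_mult_distrib_mat[OF \<phi>(1) one_carrier_mat c(2)] \<phi>(3)
    using c(2)[of i] by simp
  obtain h where h: "\<And>i. h i \<in> carrier_mat (r (Suc i)) (r i)" "u 0 = d (Suc 0) * h 0"
    "\<And>i. u (Suc i) = d (Suc (Suc i)) * h (Suc i) + h i * d (Suc i)"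
    by (rule resolution_null_homotopy[OF F u u0 chain]) (rule that)
  show ?thesis
  proof (rule that)
    show "h i \<in> carrier_mat (r (Suc i)) (r i)" for i by (rule h(1))
    show "\<phi> 0 = 1\<^sub>m (r 0) + d (Suc 0) * h 0"
      unfolding \<phi>u[of 0] h(2) ..
    show "\<phi> (Suc i) = 1\<^sub>m (r (Suc i)) + (d (Suc (Suc i)) * h (Suc i) + h i * d (Suc i))" for i
      unfolding \<phi>u[of "Suc i"] h(3) ..
  qed
qed

lemma zero_mult_mat_vec: "v \<in> carrier_vec n \<Longrightarrow> 0\<^sub>m m n *\<^sub>v v = (0\<^sub>v m :: 'a::comm_ring_1 vec)"
  by (rule eq_vecI) auto

lemma mult_mat_zero_vec: "A \<in> carrier_mat m n \<Longrightarrow> A *\<^sub>v 0\<^sub>v n = (0\<^sub>v m :: 'a::comm_ring_1 vec)"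
  by (rule eq_vecI) auto

lemma solve_add_mult_mat_vec:
  fixes D :: "'a::comm_ring_1 mat"
  assumes D: "D \<in> carrier_mat m l" and w: "w \<in> carrier_vec l" and v: "v \<in> carrier_vec m"
    and eq: "v + D *\<^sub>v w = 0\<^sub>v m"
  shows "v = D *\<^sub>v (- w)"
proof (rule eq_vecI)
  fix i assume "i < dim_vec (D *\<^sub>v (- w))"
  then have i: "i < m" using D by simp
  have "(v + D *\<^sub>v w) $ i = 0" unfolding eq using i by simp
  then have "v $ i = - ((D *\<^sub>v w) $ i)" using i D w by (simp add: eq_neg_iff_add_eq_0)
  also have "\<dots> = (D *\<^sub>v (- w)) $ i" using i D w by simp
  finally show "v $ i = (D *\<^sub>v (- w)) $ i" .
qed (use D v in auto)

text \<open>Rank-nullity for \<open>f\<close> restricted to the kernel of \<open>K\<close>: the restriction is onto because \<open>g\<close> is a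
  section of it, and its kernel is the image of \<open>D\<close>. The lemma computes the homology of a complex of
  vector spaces from a homotopy equivalence with a complex whose differentials are zero.\<close>

lemma kernel_dim_by_retraction:
  fixes K D f g :: "'k::field mat"
  assumes K: "K \<in> carrier_mat a m" and D: "D \<in> carrier_mat m l"
    and f: "f \<in> carrier_mat q m" and g: "g \<in> carrier_mat m q"
    and fg: "f * g = 1\<^sub>m q" and Kg: "K * g = 0\<^sub>m a q" and fD: "f * D = 0\<^sub>m q l"
    and KD: "K * D = 0\<^sub>m a l"
    and ker: "\<And>v. v \<in> carrier_vec m \<Longrightarrow> K *\<^sub>v v = 0\<^sub>v a \<Longrightarrow> f *\<^sub>v v = 0\<^sub>v q \<Longrightarrow>
      \<exists>w\<in>carrier_vec l. v = D *\<^sub>v w"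
  shows "kernel_dim K = q + vec_space.rank m D"
proof -
  interpret K: kernel a m K by unfold_locales (rule K)
  interpret W: vec_space "TYPE('k)" q .
  have kerK: "v \<in> mat_kernel K \<longleftrightarrow> v \<in> carrier_vec m \<and> K *\<^sub>v v = 0\<^sub>v a" for v
    using mat_kernel[OF K] by auto
  have hom: "(\<lambda>v. f *\<^sub>v v) \<in> LinearCombinations.module_hom class_ring K.VK W.V"
    unfolding LinearCombinations.module_hom_def using f
    by (auto simp: kerK mult_mat_vec mult_add_distrib_mat_vec class_ring_simps)
  interpret T: linear_map class_ring K.VK W.V "\<lambda>v. f *\<^sub>v v"
    by (intro linear_map.intro mod_hom.intro mod_hom_axioms.intro K.Ker.vectorspace_axioms
        W.vectorspace_axioms K.Ker.module_axioms W.module_axioms hom)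
  have "K.Ker.fin_dim"
    using kernel_basis_exists[OF K] unfolding K.Ker.fin_dim_def K.Ker.basis_def by auto
  from T.rank_nullity[OF this]
  have rn: "vectorspace.dim class_ring (W.vs T.im) + vectorspace.dim class_ring (K.Ker.vs T.ker) = kernel_dim K"
    by simp
  have "T.im = carrier_vec q"
  proof
    show "carrier_vec q \<subseteq> T.im"
    proof
      fix w :: "'k vec" assume w: "w \<in> carrier_vec q"
      have "K *\<^sub>v (g *\<^sub>v w) = 0\<^sub>v a"
        using assoc_mult_mat_vec[OF K g w] Kg w by (simp add: zero_mult_mat_vec)
      then have "g *\<^sub>v w \<in> mat_kernel K" using kerK g w by simp
      moreover have "f *\<^sub>v (g *\<^sub>v w) = w" using assoc_mult_mat_vec[OF f g w] fg w by simp
      ultimately show "w \<in> T.im" unfolding T.im_def by (auto intro!: image_eqI[of _ _ "g *\<^sub>v w"])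
    qed
  qed (use T.im_is_submodule in \<open>auto simp: submodule_def\<close>)
  then have "W.vs T.im = W.V" by (simp add: module_vec_def)
  then have im: "vectorspace.dim class_ring (W.vs T.im) = q" by (simp add: W.dim_is_n)
  have "T.ker = {y \<in> carrier_vec (dim_row D). \<exists>x\<in>carrier_vec (dim_col D). D *\<^sub>v x = y}"
  proof -
    have "K *\<^sub>v (D *\<^sub>v w) = 0\<^sub>v a \<and> f *\<^sub>v (D *\<^sub>v w) = 0\<^sub>v q" if "w \<in> carrier_vec l" for w
      using assoc_mult_mat_vec[OF K D that] assoc_mult_mat_vec[OF f D that] KD fD that by (simp add: zero_mult_mat_vec)
    then show ?thesis using ker D by (auto simp: T.ker_def kerK)
  qed
  then have "T.ker = K.NC.span (set (cols D))"
    using K.NC.col_space_eq[OF D] by (simp add: K.NC.col_space_def)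
  then have "vectorspace.dim class_ring (K.Ker.vs T.ker) = K.NC.rank D"
    by (simp add: K.NC.rank_def)
  then show ?thesis using rn im by simp
qed

context semiring_hom
begin

lemma mat_hom_zero: "mat\<^sub>h (0\<^sub>m p q) = 0\<^sub>m p q"
  by (rule eq_matI) auto

lemma mat_hom_add:
  assumes "A \<in> carrier_mat p q" "B \<in> carrier_mat p q"
  shows "mat\<^sub>h (A + B) = mat\<^sub>h A + mat\<^sub>h B"
  by (rule eq_matI) (use assms in \<open>auto simp: hom_add\<close>)

lemma mat_hom_one_plus_mult:
  assumes A: "A \<in> carrier_mat p q" and B: "B \<in> carrier_mat q p"
  shows "mat\<^sub>h (1\<^sub>m p + A * B) = 1\<^sub>m p + mat\<^sub>h A * mat\<^sub>h B"
  using mat_hom_add[OF one_carrier_mat mult_carrier_mat[OF A B]] mat_hom_mult[OF A B]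
  by (simp add: mat_hom_one)

lemma mat_hom_one_plus_mult_plus_mult:
  assumes A: "A \<in> carrier_mat p q" and B: "B \<in> carrier_mat q p"
    and C: "C \<in> carrier_mat p t" and E: "E \<in> carrier_mat t p"
  shows "mat\<^sub>h (1\<^sub>m p + (A * B + C * E)) = 1\<^sub>m p + (mat\<^sub>h A * mat\<^sub>h B + mat\<^sub>h C * mat\<^sub>h E)"
  using mat_hom_add[OF one_carrier_mat add_carrier_mat[OF mult_carrier_mat[OF C E]], of "A * B"]
    mat_hom_add[OF mult_carrier_mat[OF A B] mult_carrier_mat[OF C E]] mat_hom_mult[OF A B] mat_hom_mult[OF C E]
  by (simp add: mat_hom_one)

end

text \<open>The ranks of a minimal resolution are the Betti numbers computed from any resolution. Comparison
  maps \<open>f\<close>, \<open>g\<close> in both directions are mutually inverse up to homotopy. After reduction along \<open>\<rho>\<close> the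
  differentials of the minimal resolution vanish, hence the homotopy for \<open>f g\<close> disappears and
  \<open>f g = 1\<close> holds exactly, while the homotopy for \<open>g f\<close> shows that a cycle killed by \<open>f\<close> is a
  boundary.\<close>

theorem homology_of_reduced_resolution:
  fixes \<rho> :: "'a::comm_ring_1 \<Rightarrow> 'k::field"
  assumes hom: "semiring_hom \<rho>"
    and F: "free_resolution I r d" and F': "free_resolution I r' d'"
    and min: "\<And>i. map_mat \<rho> (d' (Suc i)) = 0\<^sub>m (r' i) (r' (Suc i))"
  shows "(if i = 0 then r i else kernel_dim (map_mat \<rho> (d i))) =
    r' i + vec_space.rank (r i) (map_mat \<rho> (d (Suc i)))"
proof -
  interpret semiring_hom \<rho> by (rule hom)
  note c = resolution_carrier[OF F] and c' = resolution_carrier[OF F']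
  obtain f where f: "\<And>i. f i \<in> carrier_mat (r' i) (r i)" "d' 0 * f 0 = d 0"
    "\<And>i. d' (Suc i) * f (Suc i) = f i * d (Suc i)"
    by (rule resolution_chain_map[OF F F']) (rule that)
  obtain g where g: "\<And>i. g i \<in> carrier_mat (r i) (r' i)" "d 0 * g 0 = d' 0"
    "\<And>i. d (Suc i) * g (Suc i) = g i * d' (Suc i)"
    by (rule resolution_chain_map[OF F' F]) (rule that)
  have gf: "d 0 * (g 0 * f 0) = d 0" "d (Suc i) * (g (Suc i) * f (Suc i)) = g i * f i * d (Suc i)" for i
    using assoc_mult_mat[OF c(1) g(1) f(1)] assoc_mult_mat[OF c(2) g(1) f(1), of i]
      assoc_mult_mat[OF g(1) c'(2) f(1), of i] assoc_mult_mat[OF g(1) f(1) c(2), of i] f g by simp_all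
  have fg: "d' 0 * (f 0 * g 0) = d' 0" "d' (Suc i) * (f (Suc i) * g (Suc i)) = f i * g i * d' (Suc i)" for i
    using assoc_mult_mat[OF c'(1) f(1) g(1)] assoc_mult_mat[OF c'(2) f(1) g(1), of i]
      assoc_mult_mat[OF f(1) c(2) g(1), of i] assoc_mult_mat[OF f(1) g(1) c'(2), of i] f g by simp_all
  obtain h where h: "\<And>i. h i \<in> carrier_mat (r (Suc i)) (r i)"
    "g 0 * f 0 = 1\<^sub>m (r 0) + d (Suc 0) * h 0"
    "\<And>i. g (Suc i) * f (Suc i) = 1\<^sub>m (r (Suc i)) + (d (Suc (Suc i)) * h (Suc i) + h i * d (Suc i))"
    by (rule resolution_homotopy[OF F mult_carrier_mat[OF g(1) f(1)] gf]) (rule that)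
  obtain h' where h': "\<And>i. h' i \<in> carrier_mat (r' (Suc i)) (r' i)"
    "f 0 * g 0 = 1\<^sub>m (r' 0) + d' (Suc 0) * h' 0"
    "\<And>i. f (Suc i) * g (Suc i) = 1\<^sub>m (r' (Suc i)) + (d' (Suc (Suc i)) * h' (Suc i) + h' i * d' (Suc i))"
    by (rule resolution_homotopy[OF F' mult_carrier_mat[OF f(1) g(1)] fg]) (rule that)
  let ?m = "map_mat \<rho>"
  note mc = map_carrier_mat[THEN iffD2]
  have FG: "?m (f i) * ?m (g i) = 1\<^sub>m (r' i)" for i
  proof (cases i)
    case 0
    have "?m (f 0 * g 0) = 1\<^sub>m (r' 0) + ?m (d' (Suc 0)) * ?m (h' 0)"
      unfolding h'(2) by (rule mat_hom_one_plus_mult[OF c'(2) h'(1)])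
    then show ?thesis using 0 mat_hom_mult[OF f(1) g(1), of i] h'(1)[of 0] min[of 0] by simp
  next
    case (Suc j)
    have "?m (f (Suc j) * g (Suc j)) = 1\<^sub>m (r' (Suc j)) +
      (?m (d' (Suc (Suc j))) * ?m (h' (Suc j)) + ?m (h' j) * ?m (d' (Suc j)))"
      unfolding h'(3) by (rule mat_hom_one_plus_mult_plus_mult[OF c'(2) h'(1) h'(1) c'(2)])
    then show ?thesis using Suc mat_hom_mult[OF f(1) g(1), of i] h'(1)[of "Suc j"] h'(1)[of j]
        min[of "Suc j"] min[of j] by simp
  qed
  have fd: "?m (f i) * ?m (d (Suc i)) = 0\<^sub>m (r' i) (r (Suc i))" for i
    using mat_hom_mult[OF f(1) c(2), of i] mat_hom_mult[OF c'(2) f(1), of i] f(1)[of "Suc i"] 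
      f(3)[of i] min[of i] by simp
  have dg: "?m (d (Suc i)) * ?m (g (Suc i)) = 0\<^sub>m (r i) (r' (Suc i))" for i
    using mat_hom_mult[OF g(1) c'(2), of i] mat_hom_mult[OF c(2) g(1), of i] g(1)[of i] 
      g(3)[of i] min[of i] by simp
  show ?thesis
  proof (cases i)
    case 0
    \<comment> \<open>The reduced complex ends at \<open>F\<^sub>0\<close>: the map out of it is the empty matrix, whose kernel is everything.\<close>
    let ?K = "0\<^sub>m 0 (r 0) :: 'k mat"
    have GF: "?m (g 0) * ?m (f 0) = 1\<^sub>m (r 0) + ?m (d (Suc 0)) * ?m (h 0)"
      unfolding mat_hom_mult[OF g(1) f(1), symmetric] h(2) by (rule mat_hom_one_plus_mult[OF c(2) h(1)])
    have "kernel_dim ?K = r' 0 + vec_space.rank (r 0) (?m (d (Suc 0)))"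
    proof (rule kernel_dim_by_retraction[where a=0 and f="?m (f 0)" and g="?m (g 0)"])
      fix v :: "'k vec" assume v: "v \<in> carrier_vec (r 0)" and fv: "?m (f 0) *\<^sub>v v = 0\<^sub>v (r' 0)"
      have "(?m (g 0) * ?m (f 0)) *\<^sub>v v = 0\<^sub>v (r 0)"
        using assoc_mult_mat_vec[of "?m (g 0)" _ _ "?m (f 0)" _ v] g(1)[of 0] f(1)[of 0] v fv by (simp add: mult_mat_zero_vec)
      then have "v + ?m (d (Suc 0)) *\<^sub>v (?m (h 0) *\<^sub>v v) = 0\<^sub>v (r 0)"
        unfolding GF using add_mult_distrib_mat_vec[of "1\<^sub>m (r 0)" "r 0" "r 0" "?m (d (Suc 0)) * ?m (h 0)" v]
          assoc_mult_mat_vec[of "?m (d (Suc 0))" _ _ "?m (h 0)" _ v] c(2)[of 0] h(1)[of 0] v by simp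
      then have "v = ?m (d (Suc 0)) *\<^sub>v (- (?m (h 0) *\<^sub>v v))"
        by (intro solve_add_mult_mat_vec[where m="r 0" and l="r (Suc 0)"]) (use c(2)[of 0] h(1)[of 0] v in auto)
      moreover have "- (?m (h 0) *\<^sub>v v) \<in> carrier_vec (r (Suc 0))" using h(1)[of 0] v by simp
      ultimately show "\<exists>w\<in>carrier_vec (r (Suc 0)). v = ?m (d (Suc 0)) *\<^sub>v w" by blast
    qed (use f(1) g(1) FG fd c(2)[of 0] left_mult_zero_mat[of "?m (g 0)" "r 0" "r' 0" 0]
        left_mult_zero_mat[of "?m (d (Suc 0))" "r 0" "r (Suc 0)" 0] in auto)
    moreover have "kernel_dim ?K = r 0"
    proof -
      interpret K: kernel 0 "r 0" ?K by unfold_locales simp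
      have "mat_kernel ?K = carrier_vec (r 0)" by (auto simp: mat_kernel_def)
      then have "K.VK = K.NC.V" by (simp add: module_vec_def)
      then show ?thesis by (simp add: K.NC.dim_is_n)
    qed
    ultimately show ?thesis using 0 by simp
  next
    case (Suc j)
    have GF: "?m (g (Suc j)) * ?m (f (Suc j)) = 1\<^sub>m (r (Suc j)) +
      (?m (d (Suc (Suc j))) * ?m (h (Suc j)) + ?m (h j) * ?m (d (Suc j)))"
      unfolding mat_hom_mult[OF g(1) f(1), symmetric] h(3)
      by (rule mat_hom_one_plus_mult_plus_mult[OF c(2) h(1) h(1) c(2)])
    have "kernel_dim (?m (d (Suc j))) = r' (Suc j) + vec_space.rank (r (Suc j)) (?m (d (Suc (Suc j))))"
    proof (rule kernel_dim_by_retraction[where a="r j" and f="?m (f (Suc j))" and g="?m (g (Suc j))"])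
      fix v :: "'k vec" assume v: "v \<in> carrier_vec (r (Suc j))" 
        and dv: "?m (d (Suc j)) *\<^sub>v v = 0\<^sub>v (r j)"
        and fv: "?m (f (Suc j)) *\<^sub>v v = 0\<^sub>v (r' (Suc j))"
      let ?D = "?m (d (Suc (Suc j)))" and ?H = "?m (h (Suc j))" and ?H' = "?m (h j)" and ?K = "?m (d (Suc j))"
      have cs: "?D \<in> carrier_mat (r (Suc j)) (r (Suc (Suc j)))" "?H \<in> carrier_mat (r (Suc (Suc j))) (r (Suc j))"
        "?H' \<in> carrier_mat (r (Suc j)) (r j)" "?K \<in> carrier_mat (r j) (r (Suc j))"
        using c(2)[of "Suc j"] h(1)[of "Suc j"] c(2)[of j] h(1)[of j] by auto
      have "(?m (g (Suc j)) * ?m (f (Suc j))) *\<^sub>v v = 0\<^sub>v (r (Suc j))"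
        using assoc_mult_mat_vec[of "?m (g (Suc j))" _ _ "?m (f (Suc j))" _ v] g(1)[of "Suc j"]
          f(1)[of "Suc j"] v fv by (simp add: mult_mat_zero_vec)
      then have "v + (?D *\<^sub>v (?H *\<^sub>v v) + ?H' *\<^sub>v (?K *\<^sub>v v)) = 0\<^sub>v (r (Suc j))"
        unfolding GF using add_mult_distrib_mat_vec[of "1\<^sub>m (r (Suc j))" "r (Suc j)" "r (Suc j)" "?D * ?H + ?H' * ?K" v]
          add_mult_distrib_mat_vec[of "?D * ?H" "r (Suc j)" "r (Suc j)" "?H' * ?K" v]
          assoc_mult_mat_vec[OF cs(1,2) v] assoc_mult_mat_vec[OF cs(3,4) v] cs v by simp
      then have "v + ?D *\<^sub>v (?H *\<^sub>v v) = 0\<^sub>v (r (Suc j))" using dv cs v by (simp add: mult_mat_zero_vec)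
      then have "v = ?D *\<^sub>v (- (?H *\<^sub>v v))"
        by (intro solve_add_mult_mat_vec[where m="r (Suc j)" and l="r (Suc (Suc j))"]) (use cs v in auto)
      moreover have "- (?H *\<^sub>v v) \<in> carrier_vec (r (Suc (Suc j)))" using cs v by simp
      ultimately show "\<exists>w\<in>carrier_vec (r (Suc (Suc j))). v = ?D *\<^sub>v w" by blast
    next
      show "?m (d (Suc j)) * ?m (d (Suc (Suc j))) = 0\<^sub>m (r j) (r (Suc (Suc j)))"
        using mat_hom_mult[OF c(2) c(2), of j] resolution_complex[OF F, of "Suc j"] c(2)[of j]
        by (simp add: mat_hom_zero)
    qed (use f(1) g(1) FG fd dg c(2) in auto)
    then show ?thesis using Suc by simp
  qed
qed

text \<open>An exact complex of free modules whose bases \<open>B i\<close> are arbitrary finite sets becomes a resolution by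
  matrices once the bases are enumerated.\<close>

lemma free_resolution_of_based_complex:
  fixes B :: "nat \<Rightarrow> 'b set" and D :: "nat \<Rightarrow> 'b \<Rightarrow> 'b \<Rightarrow> 'a::comm_ring_1" and a :: "'b \<Rightarrow> 'a"
  assumes fin: "\<And>i. finite (B i)"
    and image: "{\<Sum>\<beta>\<in>B 0. a \<beta> * g \<beta> | g. True} = I"
    and exact0: "\<And>g. (\<Sum>\<beta>\<in>B 0. a \<beta> * g \<beta>) = 0 \<longleftrightarrow> 
      (\<exists>h. \<forall>\<beta>\<in>B 0. g \<beta> = (\<Sum>\<gamma>\<in>B 1. D 0 \<beta> \<gamma> * h \<gamma>))"
    and exact: "\<And>i g. (\<forall>\<beta>\<in>B i. (\<Sum>\<gamma>\<in>B (Suc i). D i \<beta> \<gamma> * g \<gamma>) = 0) \<longleftrightarrow>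
      (\<exists>h. \<forall>\<gamma>\<in>B (Suc i). g \<gamma> = (\<Sum>\<delta>\<in>B (Suc (Suc i)). D (Suc i) \<gamma> \<delta> * h \<delta>))"
  obtains d e where "free_resolution I (\<lambda>i. card (B i)) d"
    "\<And>i. bij_betw (e i) {..<card (B i)} (B i)"
    "\<And>i x y. x < card (B i) \<Longrightarrow> y < card (B (Suc i)) \<Longrightarrow> d (Suc i) $$ (x, y) = D i (e i x) (e (Suc i) y)"
proof -
  let ?r = "\<lambda>i. card (B i)"
  have "\<exists>e. bij_betw e {..<?r i} (B i)" for i
    using ex_bij_betw_nat_finite[OF fin] by (simp add: atLeast0LessThan)
  then obtain e where e: "\<And>i. bij_betw (e i) {..<?r i} (B i)" by metis
  define d where "d i = (case i of 0 \<Rightarrow> mat 1 (?r 0) (\<lambda>(x, y). a (e 0 y))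
    | Suc j \<Rightarrow> mat (?r j) (?r (Suc j)) (\<lambda>(x, y). D j (e j x) (e (Suc j) y)))" for i
  have d0: "d 0 = mat 1 (?r 0) (\<lambda>(x, y). a (e 0 y))"
    and dS: "d (Suc j) = mat (?r j) (?r (Suc j)) (\<lambda>(x, y). D j (e j x) (e (Suc j) y))" for j
    by (simp_all add: d_def)
  \<comment> \<open>\<open>V i g\<close> is the coordinate vector of \<open>g\<close>, a function on the basis.\<close>
  define V where "V i g = vec (?r i) (\<lambda>x. g (e i x))" for i and g :: "'b \<Rightarrow> 'a"
  have V: "V i g \<in> carrier_vec (?r i)" for i g by (simp add: V_def)
  have surj: "\<exists>g. v = V i g" if "v \<in> carrier_vec (?r i)" for v i
  proof
    show "v = V i (\<lambda>\<beta>. v $ (the_inv_into {..<?r i} (e i) \<beta>))"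
      using that e[of i] by (intro eq_vecI) (auto simp: V_def the_inv_into_f_f bij_betw_def)
  qed
  have V_eq: "V i g = V i h \<longleftrightarrow> (\<forall>\<beta>\<in>B i. g \<beta> = h \<beta>)" for i g h
  proof -
    have "V i g = V i h \<longleftrightarrow> (\<forall>x<?r i. g (e i x) = h (e i x))"
      by (auto simp: V_def vec_eq_iff)
    also have "\<dots> \<longleftrightarrow> (\<forall>\<beta>\<in>e i ` {..<?r i}. g \<beta> = h \<beta>)" by auto
    also have "e i ` {..<?r i} = B i" using e by (simp add: bij_betw_def)
    finally show ?thesis .
  qed
  have sum_V: "(\<Sum>x<?r i. c (e i x) * (V i g $ x)) = (\<Sum>\<beta>\<in>B i. c \<beta> * g \<beta>)" for c g i
    unfolding sum.reindex_bij_betw[OF e[of i], symmetric] by (rule sum.cong) (auto simp: V_def)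
  have d0V: "(d 0 *\<^sub>v V 0 g) $ 0 = (\<Sum>\<beta>\<in>B 0. a \<beta> * g \<beta>)" for g
    unfolding sum_V[symmetric] by (simp add: d0 scalar_prod_def V_def atLeast0LessThan)
  have dSV: "d (Suc i) *\<^sub>v V (Suc i) g = V i (\<lambda>\<beta>. \<Sum>\<gamma>\<in>B (Suc i). D i \<beta> \<gamma> * g \<gamma>)" for i g
    by (rule eq_vecI) (simp_all add: sum_V[symmetric], simp_all add: dS scalar_prod_def V_def atLeast0LessThan)
  have zero: "V i (\<lambda>\<beta>. 0) = 0\<^sub>v (?r i)" for i by (auto simp: V_def)
  have im: "{d (Suc i) *\<^sub>v w | w. w \<in> carrier_vec (?r (Suc i))} =
      {V i (\<lambda>\<beta>. \<Sum>\<gamma>\<in>B (Suc i). D i \<beta> \<gamma> * h \<gamma>) | h. True}" for i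
    unfolding dSV[symmetric] using surj V by blast
  have ker: "mat_kernel (d i) = {V i g | g. \<exists>h. \<forall>\<beta>\<in>B i. g \<beta> = (\<Sum>\<gamma>\<in>B (Suc i). D i \<beta> \<gamma> * h \<gamma>)}" for i
  proof (cases i)
    case 0
    have "mat_kernel (d 0) = {v \<in> carrier_vec (?r 0). (d 0 *\<^sub>v v) $ 0 = 0}"
    proof -
      have dims: "dim_row (d 0) = 1" "dim_col (d 0) = ?r 0" by (simp_all add: d0)
      have "w = 0\<^sub>v 1 \<longleftrightarrow> w $ 0 = 0" if "dim_vec w = 1" for w :: "'a vec"
        using that by (auto simp: vec_eq_iff)
      then have "d 0 *\<^sub>v v = 0\<^sub>v 1 \<longleftrightarrow> (d 0 *\<^sub>v v) $ 0 = 0" for v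
        using dims by (metis dim_mult_mat_vec)
      then show ?thesis by (simp add: mat_kernel_def dims)
    qed
    also have "\<dots> = {V 0 g | g. (d 0 *\<^sub>v V 0 g) $ 0 = 0}" using surj V by blast
    finally show ?thesis unfolding d0V exact0 using 0 by simp
  next
    case (Suc j)
    have "mat_kernel (d (Suc j)) = {V (Suc j) g | g. d (Suc j) *\<^sub>v V (Suc j) g = V j (\<lambda>\<beta>. 0)}"
      unfolding zero using surj V by (auto simp: mat_kernel_def dS)
    then show ?thesis unfolding dSV V_eq exact Suc .
  qed
  have "free_resolution I ?r d"
    unfolding free_resolution_def
  proof (intro conjI allI)
    show "{(d 0 *\<^sub>v v) $ 0 |v. v \<in> carrier_vec (?r 0)} = I"
    proof -
      have "{(d 0 *\<^sub>v v) $ 0 |v. v \<in> carrier_vec (?r 0)} = {(d 0 *\<^sub>v V 0 g) $ 0 |g. True}"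
        using surj V by blast
      then show ?thesis unfolding d0V image .
    qed
    show "mat_kernel (d i) = {d (Suc i) *\<^sub>v w |w. w \<in> carrier_vec (?r (Suc i))}" for i
      unfolding im ker V_eq[symmetric] by blast
  qed (simp_all add: d0 dS)
  then show ?thesis using e by (intro that[of d e]) (simp_all add: dS)
qed

section \<open>Koszul complexes and division with remainder\<close>

text \<open>The Koszul complex on the elements \<open>f v\<close>, \<open>v \<in> L\<close>: an element of its underlying module is the family
  of its coefficients at the basis vectors \<open>e\<^sub>A\<close>, \<open>A \<subseteq> L\<close>.\<close>

definition koszul :: "(nat \<Rightarrow> 'r::comm_ring_1) \<Rightarrow> nat set \<Rightarrow> (nat set \<Rightarrow> 'r) \<Rightarrow> nat set \<Rightarrow> 'r" where
  "koszul f L z A = (\<Sum>v\<in>L - A. (-1) ^ card {u\<in>A. u < v} * f v * z (insert v A))"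

lemma koszul_empty: "koszul f {} z A = 0"
  by (simp add: koszul_def)

lemma koszul_eq_zero: "(\<And>v. v \<in> L - A \<Longrightarrow> z (insert v A) = 0) \<Longrightarrow> koszul f L z A = 0"
  by (simp add: koszul_def)

text \<open>Adjoining one more element makes the Koszul complex the mapping cone of multiplication by it. It
  has to be the largest index for the signs to be undisturbed.\<close>

lemma koszul_insert_max:
  assumes "finite L" "\<And>u. u \<in> L \<Longrightarrow> u < m" "A \<subseteq> L"
  shows "koszul f (insert m L) z A = koszul f L z A + (-1) ^ card A * f m * z (insert m A)"
    and "koszul f (insert m L) z (insert m A) = koszul f L (\<lambda>B. z (insert m B)) A"
proof -
  have m: "m \<notin> L" "m \<notin> A" using assms by auto
  have "insert m L - A = insert m (L - A)" using m by auto
  moreover have "{u \<in> A. u < m} = A" using assms by auto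
  ultimately show "koszul f (insert m L) z A = koszul f L z A + (-1) ^ card A * f m * z (insert m A)"
    using assms m by (simp add: koszul_def algebra_simps)
  have L: "insert m L - insert m A = L - A" using m by auto
  have "{u \<in> insert m A. u < v} = {u \<in> A. u < v}" if "v \<in> L" for v using assms(2)[OF that] by auto
  then show "koszul f (insert m L) z (insert m A) = koszul f L (\<lambda>B. z (insert m B)) A"
    unfolding koszul_def L by (intro sum.cong) (auto simp: insert_commute)
qed

lemma koszul_koszul:
  assumes "finite L" "A \<subseteq> L"
  shows "koszul f L (koszul f L z) A = 0"
  using assms
proof (induction L arbitrary: A z rule: finite_linorder_max_induct)
  case empty then show ?case by (simp add: koszul_empty)
next
  case (insert m L)
  let ?d = "koszul f L" and ?D = "koszul f (insert m L)"
  have max: "finite L" "\<And>u. u \<in> L \<Longrightarrow> u < m" using insert by auto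
  have m: "m \<notin> L" using max by blast
  define z1 where "z1 = (\<lambda>B. z (insert m B))"
  have ins: "?d (\<lambda>B. ?D z (insert m B)) B = ?d (?d z1) B" if "B \<subseteq> L" for B
    unfolding koszul_def[of f L "\<lambda>B. ?D z (insert m B)"] koszul_def[of f L "?d z1"]
  proof (rule sum.cong)
    fix v assume "v \<in> L - B"
    then have "insert v B \<subseteq> L" using that by auto
    from koszul_insert_max(2)[OF max this, of f z]
    show "(-1) ^ card {u\<in>B. u < v} * f v * ?D z (insert m (insert v B)) =
        (-1) ^ card {u\<in>B. u < v} * f v * ?d z1 (insert v B)"
      unfolding z1_def by (simp only:)
  qed simp
  show ?case
  proof (cases "m \<in> A")
    case True
    define B where "B = A - {m}"
    have B: "A = insert m B" "B \<subseteq> L" using True insert.prems by (auto simp: B_def)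
    show ?thesis
      using koszul_insert_max(2)[OF max B(2), of f "?D z"] ins[OF B(2)] insert.IH[OF B(2)] B(1) by simp
  next
    case False
    then have A: "A \<subseteq> L" using insert.prems by auto
    have "?d (?D z) A = (\<Sum>v\<in>L - A. (-1) ^ card {u\<in>A. u < v} * f v *
       (?d z (insert v A) - (-1) ^ card A * f m * z1 (insert v A)))"
      unfolding koszul_def[of f L "?D z"]
    proof (rule sum.cong)
      fix v assume v: "v \<in> L - A"
      then have "card (insert v A) = Suc (card A)" using finite_subset[OF A] max by simp
      then show "(-1) ^ card {u\<in>A. u < v} * f v * ?D z (insert v A) = (-1) ^ card {u\<in>A. u < v} * f v *
         (?d z (insert v A) - (-1) ^ card A * f m * z1 (insert v A))"
        using koszul_insert_max(1)[OF max, of "insert v A" f z] v A by (simp add: z1_def insert_commute)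
    qed simp
    also have "\<dots> = ?d (?d z) A - (-1) ^ card A * f m * ?d z1 A"
      unfolding koszul_def[of f L "?d z"] koszul_def[of f L z1] 
      by (simp add: sum_distrib_left sum_subtractf algebra_simps)
    finally have "?d (?D z) A = - ((-1) ^ card A * f m * ?d z1 A)" using insert.IH A by simp
    moreover have "?D z (insert m A) = ?d z1 A" using koszul_insert_max(2)[OF max A, of f z] by (simp add: z1_def)
    ultimately show ?thesis using koszul_insert_max(1)[OF max A, of f "?D z"] by simp
  qed
qed

lemma additive_map_sum:
  fixes H :: "'r::ab_group_add \<Rightarrow> 's::ab_group_add"
  assumes "\<And>x y. H (x + y) = H x + H y"
  shows "H (sum g X) = (\<Sum>x\<in>X. H (g x))" "H 0 = 0" "H (- x) = - H x" "H (x - y) = H x - H y"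
proof -
  interpret additive H by unfold_locales (rule assms)
  show "H (sum g X) = (\<Sum>x\<in>X. H (g x))" "H 0 = 0" "H (- x) = - H x" "H (x - y) = H x - H y"
    by (simp_all add: sum zero minus diff)
qed

text \<open>\<open>G k\<close> is the part of the coefficient ring in which the coefficients of \<open>e\<^sub>A\<close> with \<open>k\<close> elements in \<open>A\<close>
  lie; it keeps track of an additional grading. \<open>H m\<close> is thought of as the quotient on
  division by \<open>f m\<close> with remainder.\<close>

locale koszul_division =
  fixes f :: "nat \<Rightarrow> 'r::comm_ring_1" and H :: "nat \<Rightarrow> 'r \<Rightarrow> 'r" and G :: "nat \<Rightarrow> 'r set"
  assumes H_add: "H m (x + y) = H m x + H m y"
    and G_0: "0 \<in> G k" and G_add: "x \<in> G k \<Longrightarrow> y \<in> G k \<Longrightarrow> x + y \<in> G k"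
    and G_uminus: "x \<in> G k \<Longrightarrow> - x \<in> G k"
begin

lemmas H_sum = additive_map_sum(1)[of "H m" for m, OF H_add]
lemmas H_0 = additive_map_sum(2)[of "H m" for m, OF H_add]
lemmas H_minus = additive_map_sum(3)[of "H m" for m, OF H_add]

lemma H_sign: "H m ((-1) ^ k * x) = (-1) ^ k * H m x"
  by (cases "even k") (simp_all add: H_minus)

lemma G_sign: "x \<in> G k \<Longrightarrow> (-1) ^ j * x \<in> G k"
  by (cases "even j") (simp_all add: G_uminus)

lemma G_diff: "x \<in> G k \<Longrightarrow> y \<in> G k \<Longrightarrow> x - y \<in> G k"
  using G_add[OF _ G_uminus] by simp

text \<open>Exactness in positive degrees. Let \<open>m\<close> be the largest index and \<open>\<epsilon>\<^sub>A = (-1)\<^bsup>|A|\<^esup>\<close>. For a cycle \<open>z\<close> the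
  component at \<open>A\<close> without \<open>m\<close> says \<open>d z(A) = - \<epsilon>\<^sub>A f\<^sub>m z(A \<union> {m})\<close>, where \<open>d\<close> is the differential of
  the complex without \<open>f\<^sub>m\<close>. Division by \<open>f\<^sub>m\<close> commutes with \<open>d\<close>, so it yields
  \<open>d (H\<^sub>m z)(A) = - \<epsilon>\<^sub>A z(A \<union> {m})\<close>. Thus the chain with coefficients \<open>\<epsilon>\<^sub>A H\<^sub>m z(A)\<close> at \<open>A \<union> {m}\<close> has a
  boundary that agrees with \<open>z\<close> wherever \<open>m\<close> occurs. What remains of \<open>z\<close>, namely its remainders
  \<open>z(A) - f\<^sub>m H\<^sub>m z(A)\<close>, is a cycle of the smaller complex.\<close>

lemma koszul_exact:
  assumes "finite L"
    and "\<And>m u y. m \<in> L \<Longrightarrow> u \<in> L \<Longrightarrow> u < m \<Longrightarrow> H m (f u * y) = f u * H m y"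
    and "\<And>m k y. m \<in> L \<Longrightarrow> y \<in> G (Suc k) \<Longrightarrow> H m (f m * y) = y"
    and "\<And>m k y. m \<in> L \<Longrightarrow> y \<in> G (Suc k) \<Longrightarrow> f m * y \<in> G k"
    and "\<And>m k y. m \<in> L \<Longrightarrow> y \<in> G k \<Longrightarrow> H m y \<in> G (Suc k)"
    and "\<And>A. z A \<noteq> 0 \<Longrightarrow> A \<subseteq> L \<and> card A = Suc i" and "\<And>A. z A \<in> G (card A)"
    and "\<And>A. A \<subseteq> L \<Longrightarrow> koszul f L z A = 0"
  shows "\<exists>y. (\<forall>A. y A \<noteq> 0 \<longrightarrow> A \<subseteq> L \<and> card A = Suc (Suc i)) \<and> (\<forall>A. y A \<in> G (card A)) \<and>
    (\<forall>A\<subseteq>L. koszul f L y A = z A)"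
  using assms
proof (induction L arbitrary: z rule: finite_linorder_max_induct)
  case empty
  then have "z {} = 0" by force
  then show ?case by (intro exI[of _ "\<lambda>A. 0"]) (simp add: koszul_empty G_0)
next
  case (insert m L)
  let ?d = "koszul f L" and ?D = "koszul f (insert m L)"
  have max: "finite L" "\<And>u. u \<in> L \<Longrightarrow> u < m" using insert by auto
  have m: "m \<notin> L" using max by blast
  note comm = insert.prems(1) and div = insert.prems(2)[of m, simplified] 
    and fG = insert.prems(3) and HG = insert.prems(4) and zS = insert.prems(5)
    and zG = insert.prems(6) and dz = insert.prems(7)
  have fin: "finite A" if "A \<subseteq> L" for A using that max(1) finite_subset by auto
  have Hd: "H m (?d z A) = (\<Sum>v\<in>L - A. (-1) ^ card {u\<in>A. u < v} * f v * H m (z (insert v A)))" for A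
    unfolding koszul_def H_sum by (rule sum.cong) (use comm max in \<open>simp_all add: H_sign mult.assoc\<close>)
  have zm: "?d z A = - ((-1) ^ card A * (f m * z (insert m A)))" if "A \<subseteq> L" for A
    using dz[of A] koszul_insert_max(1)[OF max that, of f z] that
    by (auto simp: eq_neg_iff_add_eq_0 mult.assoc)
  have zmG: "z (insert m A) \<in> G (Suc (card A))" if "A \<subseteq> L" for A
    using zG[of "insert m A"] fin[OF that] m that by (metis card_insert_disjoint subsetD)
  have Hdz: "H m (?d z A) = - ((-1) ^ card A * z (insert m A))" if "A \<subseteq> L" for A
    using zm[OF that] div[OF zmG[OF that]] by (simp add: H_minus H_sign)
  \<comment> \<open>\<open>y1 A\<close> is the coefficient at \<open>insert m A\<close> of the chain \<open>y0\<close> whose boundary absorbs the part of \<open>z\<close> at sets containing \<open>m\<close>.\<close>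
  define y1 where "y1 A = (if A \<subseteq> L then (-1) ^ card A * H m (z A) else 0)" for A
  define y0 where "y0 A = (if m \<in> A then y1 (A - {m}) else 0)" for A
  define z' where "z' A = (if A \<subseteq> L then z A - f m * H m (z A) else 0)" for A
  have y0m: "y0 (insert m A) = y1 A" if "A \<subseteq> L" for A
  proof -
    have "m \<notin> A" using that m by blast
    then show ?thesis by (simp add: y0_def)
  qed
  have "?d z' A = 0" if A: "A \<subseteq> L" for A
  proof -
    have "?d z' A = (\<Sum>v\<in>L - A. (-1) ^ card {u\<in>A. u < v} * f v * (z (insert v A) - f m * H m (z (insert v A))))"
      unfolding koszul_def by (rule sum.cong) (use A in \<open>auto simp: z'_def\<close>)
    also have "\<dots> = ?d z A - f m * H m (?d z A)"
      unfolding Hd by (simp add: koszul_def sum_subtractf algebra_simps sum_distrib_left)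
    also have "\<dots> = 0" unfolding Hdz[OF A] unfolding zm[OF A] by (simp add: algebra_simps)
    finally show ?thesis .
  qed
  moreover have "A \<subseteq> L \<and> card A = Suc i" if "z' A \<noteq> 0" for A
    using that zS[of A] by (cases "z A = 0") (auto simp: z'_def H_0 split: if_splits)
  moreover have "z' A \<in> G (card A)" for A
    using zG[of A] fG[of m] HG[of m] by (auto simp: z'_def G_0 intro!: G_diff)
  ultimately obtain y' where y': "\<And>A. y' A \<noteq> 0 \<Longrightarrow> A \<subseteq> L \<and> card A = Suc (Suc i)"
    "\<And>A. y' A \<in> G (card A)" "\<And>A. A \<subseteq> L \<Longrightarrow> ?d y' A = z' A"
    using insert.IH[of z'] comm insert.prems(2) fG HG by auto
  define y where "y A = y' A + y0 A" for A
  have "A \<subseteq> insert m L \<and> card A = Suc (Suc i)" if "y A \<noteq> 0" for A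
  proof -
    have "y' A \<noteq> 0 \<or> y0 A \<noteq> 0" using that by (auto simp: y_def)
    then show ?thesis
    proof
      assume "y0 A \<noteq> 0"
      then have A: "m \<in> A" "A - {m} \<subseteq> L" "z (A - {m}) \<noteq> 0"
        by (auto simp: y0_def y1_def H_0 split: if_splits)
      then show ?thesis using zS[of "A - {m}"] fin[of "A - {m}"]
        by (metis card.remove finite_Diff2 finite.emptyI finite_insert insert_mono insert_Diff)
    qed (use y'(1) in auto)
  qed
  moreover have "y A \<in> G (card A)" for A
  proof -
    have "y0 A \<in> G (card A)"
    proof (cases "m \<in> A \<and> A - {m} \<subseteq> L")
      case True
      then have "card A = Suc (card (A - {m}))" using fin[of "A - {m}"] 
        by (metis card.remove finite_Diff2 finite.emptyI finite_insert)
      moreover have "H m (z (A - {m})) \<in> G (Suc (card (A - {m})))" using HG zG by blast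
      ultimately show ?thesis using True G_sign by (simp add: y0_def y1_def)
    qed (auto simp: y0_def y1_def G_0)
    then show ?thesis using y'(2) by (simp add: y_def G_add)
  qed
  moreover have "?D y A = z A" if A: "A \<subseteq> insert m L" for A
  proof (cases "m \<in> A")
    case True
    define B where "B = A - {m}"
    have B: "A = insert m B" "B \<subseteq> L" using True A by (auto simp: B_def)
    have "?D y A = ?d (\<lambda>B. y (insert m B)) B" unfolding B(1) by (rule koszul_insert_max(2)[OF max B(2)])
    also have "\<dots> = (\<Sum>v\<in>L - B. (-1) ^ card {u\<in>B. u < v} * f v * (- ((-1) ^ card B * H m (z (insert v B)))))"
      unfolding koszul_def
    proof (rule sum.cong)
      fix v assume v: "v \<in> L - B"
      have "y' (insert m (insert v B)) = 0" using y'(1) m by blast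
      moreover have "y1 (insert v B) = - ((-1) ^ card B * H m (z (insert v B)))"
        using v B(2) fin[OF B(2)] by (simp add: y1_def)
      ultimately show "(-1) ^ card {u\<in>B. u < v} * f v * y (insert m (insert v B)) =
        (-1) ^ card {u\<in>B. u < v} * f v * (- ((-1) ^ card B * H m (z (insert v B))))"
        using y0m[of "insert v B"] v B(2) by (simp add: y_def)
    qed simp
    also have "\<dots> = - ((-1) ^ card B * H m (?d z B))"
      unfolding Hd by (simp add: sum_distrib_left sum_negf algebra_simps)
    also have "\<dots> = z A" unfolding Hdz[OF B(2)] B(1) by (simp add: mult.assoc[symmetric])
    finally show ?thesis .
  next
    case False
    then have A: "A \<subseteq> L" using A by auto
    have "?d y A = ?d y' A"
      unfolding koszul_def by (rule sum.cong) (use A m in \<open>auto simp: y_def y0_def\<close>)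
    moreover have "y (insert m A) = y1 A" using y0m[OF A] y'(1)[of "insert m A"] m by (auto simp: y_def)
    ultimately have "?D y A = z' A + (-1) ^ card A * f m * y1 A"
      using koszul_insert_max(1)[OF max A, of f y] y'(3)[OF A] by simp
    also have "\<dots> = z A" using A by (simp add: z'_def y1_def algebra_simps mult.assoc[symmetric])
    finally show ?thesis .
  qed
  ultimately show ?case by blast
qed

text \<open>Dividing successively by all \<open>f m\<close>, from the largest index down, gives a remainder that is reduced
  (\<open>N m\<close>) with respect to each of them. The last conjunct, that a property \<open>N m\<close> of a later index
  survives, is what makes the induction go through.\<close>

lemma koszul_normal_form:
  assumes "finite L"
    and "\<And>m k y. m \<in> L \<Longrightarrow> y \<in> G (Suc k) \<Longrightarrow> f m * y \<in> G k"
    and "\<And>m k y. m \<in> L \<Longrightarrow> y \<in> G k \<Longrightarrow> H m y \<in> G (Suc k)"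
    and "\<And>m y. m \<in> L \<Longrightarrow> y \<in> G 0 \<Longrightarrow> N m (y - f m * H m y)"
    and "\<And>m u y. u \<in> L \<Longrightarrow> u < m \<Longrightarrow> N m y \<Longrightarrow> N m (y - f u * H u y)"
    and "z \<in> G 0"
  shows "\<exists>y. (\<forall>v. y v \<in> G 1) \<and> (\<forall>m\<in>L. N m (z - (\<Sum>v\<in>L. f v * y v))) \<and>
    (\<forall>m. (\<forall>u\<in>L. u < m) \<longrightarrow> N m z \<longrightarrow> N m (z - (\<Sum>v\<in>L. f v * y v)))"
  using assms
proof (induction L arbitrary: z rule: finite_linorder_max_induct)
  case empty
  then show ?case by (intro exI[of _ "\<lambda>v. 0"]) (simp add: G_0)
next
  case (insert m L)
  have max: "finite L" "\<And>u. u \<in> L \<Longrightarrow> u < m" using insert by auto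
  have m: "m \<notin> L" using max by blast
  define z' where "z' = z - f m * H m z"
  have HG: "H m z \<in> G 1" using insert.prems(2)[of m z 0] insert.prems(5) by simp
  have "z' \<in> G 0" using HG insert.prems(1)[of m "H m z" 0] insert.prems(5) 
    by (simp add: z'_def G_diff)
  then have "\<exists>y. (\<forall>v. y v \<in> G 1) \<and> (\<forall>k\<in>L. N k (z' - (\<Sum>v\<in>L. f v * y v))) \<and>
    (\<forall>k. (\<forall>u\<in>L. u < k) \<longrightarrow> N k z' \<longrightarrow> N k (z' - (\<Sum>v\<in>L. f v * y v)))"
    by (intro insert.IH) (use insert.prems in auto)
  then obtain y where y: "\<And>v. y v \<in> G 1" "\<And>k. k \<in> L \<Longrightarrow> N k (z' - (\<Sum>v\<in>L. f v * y v))"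
    "\<And>k. (\<forall>u\<in>L. u < k) \<Longrightarrow> N k z' \<Longrightarrow> N k (z' - (\<Sum>v\<in>L. f v * y v))"
    by blast
  define y' where "y' = y(m := H m z)"
  have "(\<Sum>v\<in>L. f v * y' v) = (\<Sum>v\<in>L. f v * y v)"
    by (rule sum.cong) (use m in \<open>auto simp: y'_def\<close>)
  then have eq: "z - (\<Sum>v\<in>insert m L. f v * y' v) = z' - (\<Sum>v\<in>L. f v * y v)"
    using max m by (simp add: z'_def y'_def)
  have "y' v \<in> G 1" for v using y(1) HG by (simp add: y'_def)
  moreover have "N m z'" unfolding z'_def using insert.prems by simp
  moreover have "N k z'" if "m < k" "N k z" for k
    unfolding z'_def using that insert.prems(4)[of m k z] by simp
  ultimately show ?case using y max by (intro exI[of _ y']) (auto simp: eq)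
qed

end

section \<open>Division in a bigraded polynomial ring\<close>

abbreviation lookup :: "('i \<Rightarrow>\<^sub>0 'c::zero) \<Rightarrow> 'i \<Rightarrow> 'c" where "lookup \<equiv> Poly_Mapping.lookup"
abbreviation keys :: "('i \<Rightarrow>\<^sub>0 'c::zero) \<Rightarrow> 'i set" where "keys \<equiv> Poly_Mapping.keys"

lemma lookup_single_mult_add:
  fixes p :: "('i::cancel_comm_monoid_add) \<Rightarrow>\<^sub>0 'c::comm_semiring_1"
  shows "lookup (Poly_Mapping.single \<sigma> c * p) (\<sigma> + b) = c * lookup p b"
  by (simp add: lookup_mult lookup_single when_mult)

lemma lookup_single_mult_eq_0:
  fixes p :: "('i::cancel_comm_monoid_add) \<Rightarrow>\<^sub>0 'c::comm_semiring_1"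
  assumes "\<And>b. k \<noteq> \<sigma> + b"
  shows "lookup (Poly_Mapping.single \<sigma> c * p) k = 0"
  using assms by (simp add: lookup_mult lookup_single when_mult)

lemma split_off_variable:
  fixes a :: "'i \<Rightarrow>\<^sub>0 nat"
  assumes "lookup a j \<noteq> 0"
  shows "a = Poly_Mapping.single j 1 + (a - Poly_Mapping.single j 1)"
  by (rule poly_mapping_eqI) (use assms in \<open>auto simp: lookup_add lookup_minus lookup_single when_def\<close>)

text \<open>Division by the monomial with exponent vector \<open>\<tau>\<close>, where the monomials that it does not divide are
  dropped. It is linear over all polynomials that do not involve the variables of \<open>\<tau>\<close>.\<close>

definition monomial_quotient ::
  "('i \<Rightarrow>\<^sub>0 nat) \<Rightarrow> (('i \<Rightarrow>\<^sub>0 nat) \<Rightarrow>\<^sub>0 'c::zero) \<Rightarrow> (('i \<Rightarrow>\<^sub>0 nat) \<Rightarrow>\<^sub>0 'c)" where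
  "monomial_quotient \<tau> p = Poly_Mapping.map_key (\<lambda>a. a + \<tau>) p"

lemma lookup_monomial_quotient: "lookup (monomial_quotient \<tau> p) a = lookup p (a + \<tau>)"
proof -
  have "inj (\<lambda>a. a + \<tau>)" by (auto intro: injI)
  then show ?thesis by (simp add: monomial_quotient_def map_key.rep_eq)
qed

lemma monomial_quotient_zero [simp]: "monomial_quotient \<tau> 0 = 0"
  by (rule poly_mapping_eqI) (simp add: lookup_monomial_quotient)

lemma monomial_quotient_add: "monomial_quotient \<tau> (p + q) = monomial_quotient \<tau> p + monomial_quotient \<tau> q"
  by (rule poly_mapping_eqI) (simp add: lookup_monomial_quotient lookup_add)

lemma monomial_quotient_mult:
  fixes p :: "('i \<Rightarrow>\<^sub>0 nat) \<Rightarrow>\<^sub>0 'c::comm_semiring_1"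
  shows "monomial_quotient \<tau> (Poly_Mapping.single \<tau> c * p) = Poly_Mapping.single 0 c * p"
  by (rule poly_mapping_eqI)
    (use lookup_single_mult_add[of 0 c p] in \<open>simp add: lookup_monomial_quotient add.commute[of _ \<tau>] lookup_single_mult_add\<close>)

lemma lookup_single_mult_variable:
  fixes p :: "('i \<Rightarrow>\<^sub>0 nat) \<Rightarrow>\<^sub>0 'c::comm_semiring_1" and a :: "'i \<Rightarrow>\<^sub>0 nat" and j :: 'i and c :: 'c
  shows "lookup (Poly_Mapping.single (Poly_Mapping.single j 1) c * p) a =
    (if lookup a j = 0 then 0 else c * lookup p (a - Poly_Mapping.single j 1))"
proof (cases "lookup a j = 0")
  case True
  then have "a \<noteq> Poly_Mapping.single j 1 + b" for b by (metis lookup_add lookup_single_eq add_is_0 one_neq_zero)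
  then show ?thesis using True lookup_single_mult_eq_0[of a "Poly_Mapping.single j 1" c p] by simp
next
  case False
  then show ?thesis using lookup_single_mult_add[of "Poly_Mapping.single j 1" c p "a - Poly_Mapping.single j 1"]
    unfolding split_off_variable[OF False, symmetric] using False by simp
qed

lemma monomial_quotient_commute:
  fixes p :: "('i \<Rightarrow>\<^sub>0 nat) \<Rightarrow>\<^sub>0 'c::comm_semiring_1"
  assumes "i \<noteq> j"
  shows "monomial_quotient (Poly_Mapping.single i 1) (Poly_Mapping.single (Poly_Mapping.single j 1) c * p) =
    Poly_Mapping.single (Poly_Mapping.single j 1) c * monomial_quotient (Poly_Mapping.single i 1) p"
proof (rule poly_mapping_eqI)
  fix a :: "'i \<Rightarrow>\<^sub>0 nat"
  have j: "lookup (a + Poly_Mapping.single i 1) j = lookup a j"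
    using assms by (simp add: lookup_add lookup_single)
  have "a + Poly_Mapping.single i 1 - Poly_Mapping.single j 1 = a - Poly_Mapping.single j 1 + Poly_Mapping.single i 1"
    by (rule poly_mapping_eqI) (use assms in \<open>auto simp: lookup_add lookup_minus lookup_single when_def\<close>)
  then show "lookup (monomial_quotient (Poly_Mapping.single i 1) (Poly_Mapping.single (Poly_Mapping.single j 1) c * p)) a =
    lookup (Poly_Mapping.single (Poly_Mapping.single j 1) c * monomial_quotient (Poly_Mapping.single i 1) p) a"
    unfolding lookup_monomial_quotient lookup_single_mult_variable j by simp
qed

text \<open>The ring \<open>S[Y\<^sub>1, Y\<^sub>2, \<dots>]\<close> in which the Koszul complex lives. The subring with the variables
  \<open>Y\<^sub>1, \<dots>, Y\<^sub>n\<^sub>-\<^sub>1\<close> maps onto the Rees algebra of the ideal when \<open>Y\<^sub>j\<close> is sent to the \<open>j\<close>-th generator.\<close>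

type_synonym ('v, 'k) rees = "(nat \<Rightarrow>\<^sub>0 nat) \<Rightarrow>\<^sub>0 ('v, 'k) mpoly"

definition YX :: "nat \<Rightarrow> 'v \<Rightarrow> ('v, 'k::field) rees" where
  "YX j v = Poly_Mapping.single (Poly_Mapping.single j 1) (Var v)"

definition YX_quotient :: "nat \<Rightarrow> 'v \<Rightarrow> ('v, 'k::field) rees \<Rightarrow> ('v, 'k) rees" where
  "YX_quotient j v z = Poly_Mapping.map (monomial_quotient (Poly_Mapping.single v 1))
     (monomial_quotient (Poly_Mapping.single j 1) z)"

lemma lookup_YX_mult: "lookup (YX j v * z) b =
  (if lookup b j = 0 then 0 else Var v * lookup z (b - Poly_Mapping.single j 1))"
  unfolding YX_def by (rule lookup_single_mult_variable)

lemma lookup_YX_quotient: "lookup (YX_quotient j v z) b =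
  monomial_quotient (Poly_Mapping.single v 1) (lookup z (b + Poly_Mapping.single j 1))"
  by (simp add: YX_quotient_def map.rep_eq lookup_monomial_quotient when_def)

lemma YX_quotient_add: "YX_quotient j v (y + z) = YX_quotient j v y + YX_quotient j v z"
  by (rule poly_mapping_eqI) (simp add: lookup_YX_quotient lookup_add monomial_quotient_add)

lemma YX_quotient_YX_mult: "YX_quotient j v (YX j v * z) = z"
proof (rule poly_mapping_eqI)
  fix b
  have "lookup (YX j v * z) (b + Poly_Mapping.single j 1) = Var v * lookup z b"
    by (simp add: lookup_YX_mult lookup_add)
  then show "lookup (YX_quotient j v (YX j v * z)) b = lookup z b"
    by (simp add: lookup_YX_quotient Var_def monomial_quotient_mult)
qed

lemma YX_quotient_commute:
  assumes "j \<noteq> k" "v \<noteq> w"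
  shows "YX_quotient j v (YX k w * z) = YX k w * YX_quotient j v z"
proof (rule poly_mapping_eqI)
  fix b :: "nat \<Rightarrow>\<^sub>0 nat"
  have k: "lookup (b + Poly_Mapping.single j 1) k = lookup b k"
    using assms by (simp add: lookup_add lookup_single)
  have "b + Poly_Mapping.single j 1 - Poly_Mapping.single k 1 = b - Poly_Mapping.single k 1 + Poly_Mapping.single j 1"
    by (rule poly_mapping_eqI) (use assms in \<open>auto simp: lookup_add lookup_minus lookup_single when_def\<close>)
  then show "lookup (YX_quotient j v (YX k w * z)) b = lookup (YX k w * YX_quotient j v z) b"
    unfolding lookup_YX_quotient lookup_YX_mult k
    by (simp add: Var_def monomial_quotient_commute[OF assms(2), simplified])
qed

lemma YX_quotient_YX_quotient: "YX_quotient j v (YX_quotient k w z) = YX_quotient k w (YX_quotient j v z)"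
  by (rule poly_mapping_eqI, simp add: lookup_YX_quotient, rule poly_mapping_eqI)
    (simp add: lookup_monomial_quotient add_ac)

lemma funpow_commute_mult:
  fixes T :: "'r::monoid_mult \<Rightarrow> 'r"
  assumes "\<And>z. T (c * z) = c * T z"
  shows "(T ^^ k) (c * z) = c * (T ^^ k) z"
  by (induction k) (simp_all add: assms)

lemma funpow_additive:
  fixes T :: "'r::plus \<Rightarrow> 'r"
  assumes "\<And>y z. T (y + z) = T y + T z"
  shows "(T ^^ k) (y + z) = (T ^^ k) y + (T ^^ k) z"
  by (induction k) (simp_all add: assms)

lemma commute_mult_power:
  fixes T :: "'r::monoid_mult \<Rightarrow> 'r"
  assumes "\<And>z. T (c * z) = c * T z"
  shows "T (c ^ k * z) = c ^ k * T z"
  by (induction k arbitrary: z) (simp_all add: assms mult.assoc)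

text \<open>The combinatorial input of the Koszul complex: the variable \<open>Y\<^sub>j\<close> belongs to the edge by which the \<open>j\<close>-th
  vertex \<open>x j\<close> is attached to the earlier ones, \<open>q j\<close> is the index of an earlier edge adjacent to it,
  and \<open>x (w j)\<close> is the end of that edge which the two do not share.\<close>

locale leaf_order =
  fixes n s :: nat and x :: "nat \<Rightarrow> 'v" and q w :: "nat \<Rightarrow> nat"
  assumes inj: "inj_on x {..<n}"
    and earlier: "\<And>j. j \<in> {2..<n} \<Longrightarrow> 1 \<le> q j \<and> q j < j \<and> w j < j"
begin

text \<open>\<open>F j = X\<^sub>j Y\<^sub>j - C j\<close> is a syzygy between the generators of two adjacent edges. Neither \<open>X\<^sub>j\<close> nor \<open>Y\<^sub>j\<close>
  occurs in \<open>C j\<close> or in \<open>F u\<close> for \<open>u < j\<close>.\<close>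

definition C :: "nat \<Rightarrow> ('v, 'k::field) rees" where "C j = YX (q j) (x (w j))"

definition F :: "nat \<Rightarrow> ('v, 'k::field) rees" where "F j = YX j (x j) - C j"

abbreviation (input) "Q j \<equiv> YX_quotient j (x j)"

text \<open>The quotient on division by \<open>F j\<close> with respect to the leading monomial \<open>X\<^sub>j Y\<^sub>j\<close>: each step of the
  division replaces \<open>X\<^sub>j Y\<^sub>j\<close> by \<open>C j\<close>, which gives a geometric series. Every application of \<open>Q j\<close> lowers
  the degree in \<open>Y\<close>, so for degree at most \<open>s\<close> the terms \<open>k > s\<close> vanish.\<close>

definition H :: "nat \<Rightarrow> ('v, 'k::field) rees \<Rightarrow> ('v, 'k) rees" where
  "H j z = (\<Sum>k<Suc s. C j ^ k * (Q j ^^ Suc k) z)"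

definition Mon :: "nat \<Rightarrow> (nat \<Rightarrow>\<^sub>0 nat) set" where
  "Mon t = {b. keys b \<subseteq> {1..<n} \<and> (\<Sum>j\<in>{1..<n}. lookup b j) = t}"

text \<open>The coefficients that occur at \<open>k\<close>-element sets in the strand of degree \<open>s\<close>: forms of degree \<open>s - k\<close>
  in \<open>Y\<close>, where each Koszul generator counts as degree one.\<close>

definition G :: "nat \<Rightarrow> ('v, 'k::field) rees set" where
  "G k = {z. \<forall>b. lookup z b \<noteq> 0 \<longrightarrow> k \<le> s \<and> b \<in> Mon (s - k)}"

lemmas Q_sum = additive_map_sum(1)[of "YX_quotient j v" for j v, OF YX_quotient_add]
lemmas Q_pow_add = funpow_additive[of "YX_quotient j v" for j v, OF YX_quotient_add]
lemmas Q_pow_zero = additive_map_sum(2)[of "YX_quotient j v ^^ k" for j v k, OF Q_pow_add]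
lemmas Q_pow_diff = additive_map_sum(4)[of "YX_quotient j v ^^ k" for j v k, OF Q_pow_add]
lemmas Q_diff = additive_map_sum(4)[of "YX_quotient j v" for j v, OF YX_quotient_add]

lemma x_neq: "i < n \<Longrightarrow> j < n \<Longrightarrow> i \<noteq> j \<Longrightarrow> x i \<noteq> x j"
  using inj by (auto simp: inj_on_def)

lemma Q_C: "j \<in> {2..<n} \<Longrightarrow> u \<in> {2..<n} \<Longrightarrow> u \<le> j \<Longrightarrow> Q j (C u * z) = C u * Q j z"
  unfolding C_def using earlier[of u] x_neq[of j "w u"] by (intro YX_quotient_commute) auto

lemma Q_F: "j \<in> {2..<n} \<Longrightarrow> Q j (F j * z) = z - C j * Q j z"
  unfolding F_def left_diff_distrib Q_diff by (simp add: Q_C YX_quotient_YX_mult)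

lemma Q_F_less: "j \<in> {2..<n} \<Longrightarrow> u \<in> {2..<n} \<Longrightarrow> u < j \<Longrightarrow> Q j (F u * z) = F u * Q j z"
  unfolding F_def left_diff_distrib Q_diff using x_neq[of j u] by (simp add: Q_C YX_quotient_commute)

lemma H_add: "H j (y + z) = H j y + H j z"
  unfolding H_def Q_pow_add by (simp only: distrib_left sum.distrib)

lemma H_F_less:
  assumes "j \<in> {2..<n}" "u \<in> {2..<n}" "u < j"
  shows "H j (F u * z) = F u * H j z"
  unfolding H_def sum_distrib_left
  by (rule sum.cong) (simp_all only: funpow_commute_mult[of "Q j" "F u", OF Q_F_less[OF assms]] mult.left_commute)

lemma G_0: "0 \<in> G k" and G_add: "y \<in> G k \<Longrightarrow> z \<in> G k \<Longrightarrow> y + z \<in> G k"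
  and G_uminus: "z \<in> G k \<Longrightarrow> - z \<in> G k"
  by (auto simp: G_def lookup_add) (metis add_0)+

lemma G_sum: "(\<And>a. a \<in> A \<Longrightarrow> g a \<in> G k) \<Longrightarrow> sum g A \<in> G k"
  by (induction A rule: infinite_finite_induct) (auto simp: G_0 G_add)

lemma Mon_add_single: "j \<in> {1..<n} \<Longrightarrow> b + Poly_Mapping.single j 1 \<in> Mon t \<longleftrightarrow> b \<in> Mon (t - 1) \<and> t \<noteq> 0"
proof -
  assume j: "j \<in> {1..<n}"
  have "(\<Sum>i\<in>{1..<n}. lookup (b + Poly_Mapping.single j 1) i) = Suc (\<Sum>i\<in>{1..<n}. lookup b i)"
    using j by (simp add: lookup_add sum.distrib lookup_single when_def)
  moreover have "keys (b + Poly_Mapping.single j 1) = insert j (keys b)"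
    by (auto simp: in_keys_iff lookup_add lookup_single when_def split: if_splits)
  ultimately show ?thesis using j by (auto simp: Mon_def)
qed

lemma YX_mult_G: "z \<in> G (Suc k) \<Longrightarrow> j \<in> {1..<n} \<Longrightarrow> YX j v * z \<in> G k"
proof -
  assume z: "z \<in> G (Suc k)" and j: "j \<in> {1..<n}"
  show ?thesis unfolding G_def
  proof (intro CollectI allI impI)
    fix b assume b: "lookup (YX j v * z) b \<noteq> 0"
    then have bj: "lookup b j \<noteq> 0" and "lookup z (b - Poly_Mapping.single j 1) \<noteq> 0"
      by (auto simp: lookup_YX_mult split: if_splits)
    then have "Suc k \<le> s" "b - Poly_Mapping.single j 1 \<in> Mon (s - Suc k)" using z by (auto simp: G_def)
    then have "(b - Poly_Mapping.single j 1) + Poly_Mapping.single j 1 \<in> Mon (s - k)"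
      using Mon_add_single[OF j, of "b - Poly_Mapping.single j 1" "s - k"] by simp
    then show "k \<le> s \<and> b \<in> Mon (s - k)"
      using split_off_variable[OF bj] \<open>Suc k \<le> s\<close> by (simp add: add.commute)
  qed
qed

lemma Q_G: "z \<in> G k \<Longrightarrow> j \<in> {1..<n} \<Longrightarrow> YX_quotient j v z \<in> G (Suc k)"
  unfolding G_def
proof (intro CollectI allI impI)
  fix b assume z: "z \<in> {z. \<forall>b. lookup z b \<noteq> 0 \<longrightarrow> k \<le> s \<and> b \<in> Mon (s - k)}"
    and j: "j \<in> {1..<n}" and "lookup (YX_quotient j v z) b \<noteq> 0"
  then have "lookup z (b + Poly_Mapping.single j 1) \<noteq> 0"
    unfolding lookup_YX_quotient by (metis monomial_quotient_zero)
  then show "Suc k \<le> s \<and> b \<in> Mon (s - Suc k)" using z Mon_add_single[OF j, of b "s - k"] by auto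
qed

lemma C_mult_G: "z \<in> G (Suc k) \<Longrightarrow> j \<in> {2..<n} \<Longrightarrow> C j * z \<in> G k"
  unfolding C_def using earlier[of j] by (intro YX_mult_G) auto

lemma F_mult_G: "z \<in> G (Suc k) \<Longrightarrow> j \<in> {2..<n} \<Longrightarrow> F j * z \<in> G k"
  using YX_mult_G[of z k j "x j"] G_uminus[OF C_mult_G[of z k j]] G_add
  by (fastforce simp: F_def left_diff_distrib)

lemma Q_pow_G: "z \<in> G k \<Longrightarrow> j \<in> {1..<n} \<Longrightarrow> (YX_quotient j v ^^ l) z \<in> G (k + l)"
  by (induction l) (simp_all add: Q_G)

lemma C_pow_mult_G: "z \<in> G (k + l) \<Longrightarrow> j \<in> {2..<n} \<Longrightarrow> C j ^ l * z \<in> G k"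
proof (induction l arbitrary: z)
  case (Suc l)
  then have "C j ^ l * (C j * z) \<in> G k" by (intro Suc.IH C_mult_G) auto
  then show ?case by (simp add: mult_ac)
qed simp

lemma H_G: "z \<in> G k \<Longrightarrow> j \<in> {2..<n} \<Longrightarrow> H j z \<in> G (Suc k)"
  unfolding H_def using Q_pow_G[of z k j "Suc l" "x j" for l] by (intro G_sum C_pow_mult_G) auto

lemma G_trivial: "k > s \<Longrightarrow> z \<in> G k \<Longrightarrow> z = 0"
  by (rule poly_mapping_eqI) (auto simp: G_def)

lemma Q_pow_eq_0: "z \<in> G k \<Longrightarrow> j \<in> {1..<n} \<Longrightarrow> l + k > s \<Longrightarrow> (YX_quotient j v ^^ l) z = 0"
  using Q_pow_G[of z k j l v] G_trivial[of "k + l"] by simp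

text \<open>\<open>Q j (F j * y) = y - C j * Q j y\<close> turns the series for \<open>H j (F j * y)\<close> into a telescoping sum.\<close>

lemma H_F:
  assumes j: "j \<in> {2..<n}" and y: "y \<in> G k"
  shows "H j (F j * y) = y"
proof -
  let ?u = "\<lambda>l. C j ^ l * (Q j ^^ l) y"
  have "H j (F j * y) = (\<Sum>l<Suc s. C j ^ l * (Q j ^^ l) (y - C j * Q j y))"
    unfolding H_def by (simp only: funpow_Suc_right o_def Q_F[OF j])
  also have "\<dots> = (\<Sum>l<Suc s. ?u l - ?u (Suc l))"
  proof (rule sum.cong)
    fix l
    have "(Q j ^^ l) (y - C j * Q j y) = (Q j ^^ l) y - C j * (Q j ^^ Suc l) y"
      unfolding Q_pow_diff funpow_commute_mult[of "Q j" "C j", OF Q_C[OF j j order.refl]]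
      by (simp add: funpow_swap1)
    then show "C j ^ l * (Q j ^^ l) (y - C j * Q j y) = ?u l - ?u (Suc l)"
      by (simp only: right_diff_distrib power_Suc2 mult.assoc)
  qed simp
  also have "\<dots> = ?u 0 - ?u (Suc s)" by (rule sum_lessThan_telescope')
  also have "?u (Suc s) = 0" using Q_pow_eq_0[OF y, of j "Suc s" "x j"] j by simp
  finally show ?thesis by simp
qed

text \<open>The remainder has no monomial divisible by \<open>X\<^sub>j Y\<^sub>j\<close>. Again a telescoping sum.\<close>

lemma Q_remainder:
  assumes j: "j \<in> {2..<n}" and z: "z \<in> G k"
  shows "Q j (z - F j * H j z) = 0"
proof -
  let ?u = "\<lambda>l. C j ^ l * (Q j ^^ Suc l) z"
  have "C j * Q j (H j z) = (\<Sum>l<Suc s. ?u (Suc l))"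
    unfolding H_def Q_sum sum_distrib_left
    by (rule sum.cong) (simp_all add: commute_mult_power[of "Q j" "C j", OF Q_C[OF j j order.refl]] mult.assoc)
  then have "H j z - C j * Q j (H j z) = (\<Sum>l<Suc s. ?u l - ?u (Suc l))"
    by (simp only: H_def sum_subtractf)
  also have "\<dots> = ?u 0 - ?u (Suc s)" by (rule sum_lessThan_telescope')
  also have "?u (Suc s) = 0" using Q_pow_eq_0[OF z, of j "Suc (Suc s)" "x j"] j by simp
  finally show ?thesis unfolding Q_diff Q_F[OF j] by simp
qed

lemma Q_remainder_less:
  assumes j: "j \<in> {2..<n}" "u \<in> {2..<n}" "u < j" and z: "Q j z = 0"
  shows "Q j (z - F u * H u z) = 0"
proof -
  have "(Q u ^^ l) (Q j z) = Q j ((Q u ^^ l) z)" for l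
    by (induction l) (simp_all add: YX_quotient_YX_quotient)
  then have *: "Q j ((Q u ^^ l) z) = 0" for l
    using z Q_pow_zero by metis
  have "Q j (H u z) = 0"
    unfolding H_def Q_sum
    by (intro sum.neutral ballI)
      (simp only: commute_mult_power[of "Q j" "C u", OF Q_C[OF j(1,2) less_imp_le[OF j(3)]]] * mult_zero_right)
  then show ?thesis unfolding Q_diff using z by (simp add: Q_F_less[OF j])
qed

lemma koszul_division_F: "koszul_division H G"
  by unfold_locales (simp_all add: H_add G_0 G_add G_uminus)

end

section \<open>Strands of the Koszul complex\<close>

lemma residue_Var_mult: "residue (Var v * p) = 0"
  unfolding residue_def Var_def by (subst lookup_single_mult_variable) simp

lemma residue_add: "residue (p + q) = residue p + residue q"
  by (simp add: residue_def lookup_add)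

lemma residue_mult:
  fixes p q :: "('v, 'k::field) mpoly"
  shows "residue (p * q) = residue p * residue q"
proof -
  have "(\<Sum>k. lookup q k when 0 = l + k) = (lookup q 0 when l = 0)" for l :: "'v \<Rightarrow>\<^sub>0 nat"
  proof (cases "l = 0")
    case False
    then have "0 \<noteq> l + k" for k
      by (metis lookup_add lookup_zero add_is_0 poly_mapping_eqI)
    then show ?thesis using False by simp
  qed simp
  then show ?thesis by (simp add: residue_def lookup_mult mult_when)
qed

lemma semiring_hom_residue: "semiring_hom (residue :: ('v, 'k::field) mpoly \<Rightarrow> 'k)"
  by unfold_locales (simp_all add: residue_add residue_mult, simp_all add: residue_def)

lemma lookup_const_mult:
  fixes p :: "('i::cancel_comm_monoid_add) \<Rightarrow>\<^sub>0 'c::comm_semiring_1"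
  shows "lookup (Poly_Mapping.single 0 c * p) b = c * lookup p b"
  using lookup_single_mult_add[of 0 c p b] by simp

context leaf_order
begin

abbreviation "L \<equiv> {2..<n}"

text \<open>The \<open>S\<close>-basis \<open>e\<^sub>A Y\<^sup>b\<close> of the strand in homological degree \<open>i\<close>.\<close>

definition basis :: "nat \<Rightarrow> (nat set \<times> (nat \<Rightarrow>\<^sub>0 nat)) set" where
  "basis i = {(A, b). A \<subseteq> L \<and> card A = i \<and> i \<le> s \<and> b \<in> Mon (s - i)}"

definition strand :: "nat \<Rightarrow> (nat set \<Rightarrow> ('v, 'k::field) rees) set" where
  "strand i = {z. (\<forall>A. z A \<noteq> 0 \<longrightarrow> A \<subseteq> L \<and> card A = i) \<and> (\<forall>A. z A \<in> G (card A))}"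

definition of_coeffs :: "nat \<Rightarrow> (nat set \<times> (nat \<Rightarrow>\<^sub>0 nat) \<Rightarrow> ('v, 'k::field) mpoly) \<Rightarrow> nat set \<Rightarrow> ('v, 'k) rees" where
  "of_coeffs i g A = (\<Sum>(A', b)\<in>basis i. if A' = A then Poly_Mapping.single b (g (A', b)) else 0)"

definition entry :: "nat \<Rightarrow> nat set \<times> (nat \<Rightarrow>\<^sub>0 nat) \<Rightarrow> nat set \<times> (nat \<Rightarrow>\<^sub>0 nat) \<Rightarrow> ('v, 'k::field) mpoly" where
  "entry i \<beta> \<gamma> = lookup (koszul F L (\<lambda>A. if fst \<gamma> = A then Poly_Mapping.single (snd \<gamma>) 1 else 0) (fst \<beta>)) (snd \<beta>)"

lemma finite_Mon: "finite (Mon t)"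
proof -
  let ?T = "{1..<n} \<rightarrow>\<^sub>E {..t}"
  have "inj_on (\<lambda>b. restrict (lookup b) {1..<n}) (Mon t)"
  proof (rule inj_onI, rule poly_mapping_eqI)
    fix b b' j assume b: "b \<in> Mon t" "b' \<in> Mon t" 
      and eq: "restrict (lookup b) {1..<n} = restrict (lookup b') {1..<n}"
    show "lookup b j = lookup b' j"
    proof (cases "j \<in> {1..<n}")
      case True then show ?thesis using fun_cong[OF eq, of j] by simp
    next
      case False then show ?thesis using b by (metis (mono_tags, lifting) Mon_def in_keys_iff mem_Collect_eq subsetD)
    qed
  qed
  moreover have "(\<lambda>b. restrict (lookup b) {1..<n}) ` Mon t \<subseteq> ?T"
  proof clarify
    fix b assume b: "b \<in> Mon t"
    have "lookup b j \<le> t" if "j \<in> {1..<n}" for j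
      using b member_le_sum[of j "{1..<n}" "lookup b"] that by (auto simp: Mon_def)
    then show "restrict (lookup b) {1..<n} \<in> ?T" by auto
  qed
  moreover have "finite ?T" by (intro finite_PiE) auto
  ultimately show ?thesis by (metis finite_imageD finite_subset)
qed

lemma finite_basis: "finite (basis i)"
  by (rule finite_subset[of _ "Pow L \<times> Mon (s - i)"]) (auto simp: basis_def finite_Mon)

lemma lookup_of_coeffs: "lookup (of_coeffs i g A) b = (if (A, b) \<in> basis i then g (A, b) else 0)"
proof -
  have "lookup (of_coeffs i g A) b = (\<Sum>\<gamma>\<in>basis i. if \<gamma> = (A, b) then g (A, b) else 0)"
    unfolding of_coeffs_def lookup_sum by (rule sum.cong) (auto simp: lookup_single when_def split: prod.splits)
  then show ?thesis using finite_basis by simp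
qed

lemma of_coeffs_strand: "of_coeffs i g \<in> strand i"
proof -
  have "of_coeffs i g A = 0" if "\<not> (A \<subseteq> L \<and> card A = i)" for A
    by (rule poly_mapping_eqI) (use that in \<open>auto simp: lookup_of_coeffs basis_def\<close>)
  moreover have "of_coeffs i g A \<in> G (card A)" for A
    by (auto simp: G_def lookup_of_coeffs basis_def)
  ultimately show ?thesis by (auto simp: strand_def)
qed

lemma strand_support:
  assumes z: "z \<in> strand i" "(A, b) \<notin> basis i"
  shows "lookup (z A) b = 0"
proof (rule ccontr)
  assume nz: "lookup (z A) b \<noteq> 0"
  then have "z A \<noteq> 0" by auto
  then show False using z nz by (auto simp: strand_def basis_def G_def)
qed

lemma strand_eqI:
  assumes "z \<in> strand i" "y \<in> strand i" "\<And>A b. (A, b) \<in> basis i \<Longrightarrow> lookup (z A) b = lookup (y A) b"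
  shows "z = y"
proof (rule ext, rule poly_mapping_eqI)
  fix A b
  show "lookup (z A) b = lookup (y A) b" using assms strand_support by metis
qed

lemma of_coeffs_lookup: "z \<in> strand i \<Longrightarrow> of_coeffs i (\<lambda>(A, b). lookup (z A) b) = z"
  by (rule strand_eqI[OF of_coeffs_strand]) (simp_all add: lookup_of_coeffs)

lemma koszul_strand:
  assumes z: "z \<in> strand (Suc i)"
  shows "koszul F L z \<in> strand i"
proof -
  have "z (insert v A) = 0" if "\<not> (A \<subseteq> L \<and> card A = i)" "v \<in> L - A" for A v
  proof (rule ccontr)
    assume "z (insert v A) \<noteq> 0"
    then have "insert v A \<subseteq> L \<and> card (insert v A) = Suc i" using z by (auto simp: strand_def)
    then show False using that finite_subset[of A L] by auto
  qed
  then have 1: "koszul F L z A = 0" if "\<not> (A \<subseteq> L \<and> card A = i)" for A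
    using that by (intro koszul_eq_zero) auto
  moreover have "koszul F L z A \<in> G (card A)" for A
  proof (cases "A \<subseteq> L")
    case True
    have "F v * z (insert v A) \<in> G (card A)" if "v \<in> L - A" for v
    proof (rule F_mult_G)
      have "card (insert v A) = Suc (card A)" using that True finite_subset[of A L] by auto
      moreover have "z (insert v A) \<in> G (card (insert v A))" using z by (simp add: strand_def)
      ultimately show "z (insert v A) \<in> G (Suc (card A))" by simp
    qed (use that in auto)
    then show ?thesis unfolding koszul_def mult.assoc
      by (intro G_sum koszul_division.G_sign[OF koszul_division_F]) auto
  qed (use 1 G_0 in auto)
  ultimately show ?thesis by (auto simp: strand_def)
qed

lemma sum_entry:
  "(\<Sum>\<gamma>\<in>basis i. entry j \<beta> \<gamma> * h \<gamma>) = lookup (koszul F L (of_coeffs i h) (fst \<beta>)) (snd \<beta>)"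
proof -
  let ?e = "\<lambda>\<gamma> A. if fst \<gamma> = A then Poly_Mapping.single (snd \<gamma>) 1 else 0"
  have "of_coeffs i h A = (\<Sum>\<gamma>\<in>basis i. Poly_Mapping.single 0 (h \<gamma>) * ?e \<gamma> A)" for A
    unfolding of_coeffs_def
  proof (rule sum.cong)
    fix \<gamma> assume "\<gamma> \<in> basis i"
    show "(case \<gamma> of (A', b) \<Rightarrow> if A' = A then Poly_Mapping.single b (h (A', b)) else 0) =
      Poly_Mapping.single 0 (h \<gamma>) * ?e \<gamma> A"
      by (cases \<gamma>; cases "fst \<gamma> = A") (simp_all add: mult_single)
  qed simp
  then have "koszul F L (of_coeffs i h) A = (\<Sum>\<gamma>\<in>basis i. Poly_Mapping.single 0 (h \<gamma>) * koszul F L (?e \<gamma>) A)" for A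
    unfolding koszul_def by (simp only: sum_distrib_left, subst sum.swap, simp only: mult_ac)
  then show ?thesis
    by (simp add: lookup_sum entry_def lookup_const_mult) (simp add: mult.commute)
qed

text \<open>Every coefficient of \<open>F v\<close> is a multiple of a variable of \<open>S\<close>, so the strand is a minimal complex.\<close>

lemma residue_entry: "residue (entry i \<beta> \<gamma>) = 0"
proof -
  have 0: "residue (lookup (F v * z) b) = 0" for v z b
    unfolding F_def C_def left_diff_distrib lookup_minus lookup_YX_mult
    by (simp add: residue_def lookup_minus residue_Var_mult[unfolded residue_def])
  have "residue (lookup (koszul F L z A) b) = (\<Sum>v\<in>L - A. residue (lookup (F v * ((-1) ^ card {u\<in>A. u < v} * z (insert v A))) b))" for z A b
    unfolding koszul_def by (simp add: residue_def lookup_sum mult_ac)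
  then show ?thesis by (simp add: entry_def 0)
qed

lemma exact_strand:
  "(\<forall>\<beta>\<in>basis i. (\<Sum>\<gamma>\<in>basis (Suc i). entry i \<beta> \<gamma> * g \<gamma>) = 0) \<longleftrightarrow>
   (\<exists>h. \<forall>\<gamma>\<in>basis (Suc i). g \<gamma> = (\<Sum>\<delta>\<in>basis (Suc (Suc i)). entry (Suc i) \<gamma> \<delta> * h \<delta>))"
proof
  let ?z = "of_coeffs (Suc i) g"
  assume l: "\<forall>\<beta>\<in>basis i. (\<Sum>\<gamma>\<in>basis (Suc i). entry i \<beta> \<gamma> * g \<gamma>) = 0"
  have "koszul F L ?z = (\<lambda>A. 0)"
    by (rule strand_eqI[OF koszul_strand[OF of_coeffs_strand]])
      (use l in \<open>auto simp: sum_entry strand_def G_0\<close>)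
  then have "\<exists>y. (\<forall>A. y A \<noteq> 0 \<longrightarrow> A \<subseteq> L \<and> card A = Suc (Suc i)) \<and> (\<forall>A. y A \<in> G (card A)) \<and>
    (\<forall>A\<subseteq>L. koszul F L y A = ?z A)"
    using of_coeffs_strand[of "Suc i" g]
    by (intro koszul_division.koszul_exact[OF koszul_division_F])
      (auto simp: H_F_less H_F strand_def intro: F_mult_G H_G)
  then obtain y where y: "y \<in> strand (Suc (Suc i))" "\<And>A. A \<subseteq> L \<Longrightarrow> koszul F L y A = ?z A"
    by (auto simp: strand_def)
  show "\<exists>h. \<forall>\<gamma>\<in>basis (Suc i). g \<gamma> = (\<Sum>\<delta>\<in>basis (Suc (Suc i)). entry (Suc i) \<gamma> \<delta> * h \<delta>)"
  proof (intro exI ballI)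
    fix \<gamma> assume \<gamma>: "\<gamma> \<in> basis (Suc i)"
    then have "fst \<gamma> \<subseteq> L" by (auto simp: basis_def)
    then show "g \<gamma> = (\<Sum>\<delta>\<in>basis (Suc (Suc i)). entry (Suc i) \<gamma> \<delta> * (\<lambda>(A, b). lookup (y A) b) \<delta>)"
      unfolding sum_entry of_coeffs_lookup[OF y(1)] using y(2) \<gamma> by (simp add: lookup_of_coeffs)
  qed
next
  assume "\<exists>h. \<forall>\<gamma>\<in>basis (Suc i). g \<gamma> = (\<Sum>\<delta>\<in>basis (Suc (Suc i)). entry (Suc i) \<gamma> \<delta> * h \<delta>)"
  then obtain h where h: "\<And>\<gamma>. \<gamma> \<in> basis (Suc i) \<Longrightarrow> g \<gamma> = lookup (koszul F L (of_coeffs (Suc (Suc i)) h) (fst \<gamma>)) (snd \<gamma>)"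
    unfolding sum_entry by blast
  have "of_coeffs (Suc i) g = koszul F L (of_coeffs (Suc (Suc i)) h)"
    by (rule strand_eqI[OF of_coeffs_strand koszul_strand[OF of_coeffs_strand]])
      (simp add: lookup_of_coeffs h)
  then show "\<forall>\<beta>\<in>basis i. (\<Sum>\<gamma>\<in>basis (Suc i). entry i \<beta> \<gamma> * g \<gamma>) = 0"
    unfolding sum_entry by (auto simp: koszul_koszul basis_def)
qed

end

section \<open>The relations between the generators\<close>

lemma single_power:
  "Poly_Mapping.single (a :: 'i \<Rightarrow>\<^sub>0 nat) (1::'c::comm_semiring_1) ^ k = Poly_Mapping.single (\<Sum>i<k. a) 1"
  by (induction k) (simp_all add: mult_single add.commute)

lemma prod_single:
  "finite X \<Longrightarrow> (\<Prod>i\<in>X. Poly_Mapping.single (f i :: 'i \<Rightarrow>\<^sub>0 nat) (1::'c::comm_semiring_1)) = Poly_Mapping.single (\<Sum>i\<in>X. f i) 1"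
  by (induction X rule: finite_induct) (simp_all add: mult_single)

text \<open>The vertices of a tree, ordered so that each vertex \<open>x j\<close> with \<open>j \<ge> 1\<close> is attached to an earlier one,
  \<open>x (p j)\<close>; the edges are then numbered by \<open>1, \<dots>, n - 1\<close>. For \<open>j \<ge> 2\<close> an earlier edge at \<open>x (p j)\<close> is the one
  that attaches \<open>x (p j)\<close> itself or, if \<open>x (p j)\<close> is the root \<open>x 0\<close>, the edge numbered \<open>1\<close>.\<close>

locale tree_order =
  fixes n s :: nat and x :: "nat \<Rightarrow> 'v::finite" and p :: "nat \<Rightarrow> nat"
  assumes bij: "bij_betw x {..<n} UNIV" and parent: "\<And>j. 1 \<le> j \<Longrightarrow> j < n \<Longrightarrow> p j < j"
    and n: "2 \<le> n" and s: "1 \<le> s"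
begin

sublocale leaf_order n s x "\<lambda>j. if p j = 0 then 1 else p j" "\<lambda>j. if p j = 0 then 1 else p (p j)"
proof
  show "inj_on x {..<n}" using bij by (simp add: bij_betw_def)
  fix j assume j: "j \<in> {2..<n}"
  then have "p j < j" using parent[of j] by auto
  moreover have "p (p j) < p j" if "p j \<noteq> 0" using parent[of "p j"] that calculation j by auto
  ultimately show "1 \<le> (if p j = 0 then 1 else p j) \<and> (if p j = 0 then 1 else p j) < j \<and>
    (if p j = 0 then 1 else p (p j)) < j" using j by auto
qed

definition gen :: "nat \<Rightarrow> ('v, 'k::field) mpoly" where
  "gen j = (\<Prod>v\<in>UNIV - {x j, x (p j)}. Var v)"

definition Gen :: "(nat \<Rightarrow>\<^sub>0 nat) \<Rightarrow> ('v, 'k::field) mpoly" where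
  "Gen b = (\<Prod>j\<in>{1..<n}. gen j ^ lookup b j)"

definition expo :: "(nat \<Rightarrow>\<^sub>0 nat) \<Rightarrow> 'v \<Rightarrow>\<^sub>0 nat" where
  "expo b = (\<Sum>j\<in>{1..<n}. \<Sum>k<lookup b j. \<Sum>v\<in>UNIV - {x j, x (p j)}. Poly_Mapping.single v 1)"

text \<open>The degree of the vertex \<open>x i\<close> in the multigraph in which the edge \<open>j\<close> has multiplicity \<open>b j\<close>.\<close>

definition incidence :: "nat \<Rightarrow> (nat \<Rightarrow>\<^sub>0 nat) \<Rightarrow> nat" where
  "incidence i b = (\<Sum>j\<in>{1..<n}. if j = i \<or> p j = i then lookup b j else 0)"

lemma Gen_eq_single: "Gen b = Poly_Mapping.single (expo b) 1"
  unfolding Gen_def gen_def Var_def expo_def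
  by (simp only: prod_single finite_Diff finite single_power finite_atLeastLessThan)

lemma Gen_add_single:
  assumes j: "j \<in> {1..<n}"
  shows "(Gen (b + Poly_Mapping.single j 1) :: ('v, 'k::field) mpoly) = gen j * Gen b"
proof -
  have "(gen i :: ('v, 'k) mpoly) ^ lookup (b + Poly_Mapping.single j 1) i =
      gen i ^ lookup b i * (if i = j then gen j else 1)" for i
    by (simp add: lookup_add lookup_single when_def)
  then have "(Gen (b + Poly_Mapping.single j 1) :: ('v, 'k) mpoly) = Gen b * (\<Prod>i\<in>{1..<n}. if i = j then gen j else 1)"
    by (simp only: Gen_def prod.distrib)
  then show ?thesis using j by (simp add: mult.commute)
qed

lemma Gen_0: "Gen 0 = 1"
  by (simp add: Gen_def)

text \<open>The generator of the edge \<open>j\<close> contains \<open>x i\<close> unless the edge does, and a product of \<open>s\<close> generators is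
  taken.\<close>

lemma expo_incidence:
  assumes b: "b \<in> Mon s" and i: "i < n"
  shows "lookup (expo b) (x i) + incidence i b = s"
proof -
  have "lookup (\<Sum>v\<in>UNIV - {x j, x (p j)}. Poly_Mapping.single v 1) (x i) = (if j = i \<or> p j = i then 0 else 1 :: nat)"
    if j: "j \<in> {1..<n}" for j
  proof -
    have "x j = x i \<longleftrightarrow> j = i"
      using x_neq[of j i] i j by auto
    moreover have "x (p j) = x i \<longleftrightarrow> p j = i"
      using x_neq[of "p j" i] parent[of j] i j by auto
    ultimately show ?thesis by (simp add: lookup_sum lookup_single when_def) auto
  qed
  then have "lookup (expo b) (x i) = (\<Sum>j\<in>{1..<n}. if j = i \<or> p j = i then 0 else lookup b j)"
    unfolding expo_def lookup_sum by (intro sum.cong) auto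
  then have "lookup (expo b) (x i) + incidence i b = (\<Sum>j\<in>{1..<n}.
      (if j = i \<or> p j = i then 0 else lookup b j) + (if j = i \<or> p j = i then lookup b j else 0))"
    unfolding incidence_def by (simp only: sum.distrib)
  also have "\<dots> = (\<Sum>j\<in>{1..<n}. lookup b j)" by (rule sum.cong) auto
  finally have "lookup (expo b) (x i) + incidence i b = (\<Sum>j\<in>{1..<n}. lookup b j)" .
  then show ?thesis using b by (simp add: Mon_def)
qed

lemma incidence_split:
  assumes "i \<in> {1..<n}"
  shows "incidence i b = lookup b i + (\<Sum>j\<in>{1..<n}. if p j = i then lookup b j else 0)"
proof -
  have "(if j = i \<or> p j = i then lookup b j else 0) = (if j = i then lookup b j else 0) + (if p j = i then lookup b j else 0)"
    if "j \<in> {1..<n}" for j using parent[of j] that by auto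
  then have "incidence i b = (\<Sum>j\<in>{1..<n}. (if j = i then lookup b j else 0) + (if p j = i then lookup b j else 0))"
    unfolding incidence_def by (intro sum.cong) auto
  then show ?thesis using assms by (simp add: sum.distrib)
qed

text \<open>A normal monomial \<open>x\<^sup>a Y\<^sup>b\<close> (no factor \<open>X\<^sub>j Y\<^sub>j\<close> with \<open>j \<ge> 2\<close>) is determined by its image. At the last
  vertex \<open>x j\<close>, a leaf, the exponent of the image determines the difference of \<open>a\<close> at \<open>x j\<close> and \<open>b j\<close>; one
  of them is zero, so it determines both. Removing the leaf and continuing leaves only \<open>b 1\<close>, which the
  total degree \<open>s\<close> fixes.\<close>

lemma normal_monomials_distinct:
  assumes b: "b \<in> Mon s" "b' \<in> Mon s"
    and eq: "a + expo b = a' + expo b'"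
    and nf: "\<And>j. j \<in> L \<Longrightarrow> lookup b j = 0 \<or> lookup a (x j) = 0"
    and nf': "\<And>j. j \<in> L \<Longrightarrow> lookup b' j = 0 \<or> lookup a' (x j) = 0"
  shows "b = b'"
proof -
  have bal: "lookup a (x i) + incidence i b' = lookup a' (x i) + incidence i b" if "i < n" for i
  proof -
    have "lookup a (x i) + lookup (expo b) (x i) = lookup a' (x i) + lookup (expo b') (x i)"
      using arg_cong[OF eq, of "\<lambda>c. lookup c (x i)"] by (simp add: lookup_add)
    then show ?thesis using expo_incidence[OF b(1) that] expo_incidence[OF b(2) that] by linarith
  qed
  have L: "lookup b i = lookup b' i" if "i \<in> L" for i
    using that
  proof (induction "n - i" arbitrary: i rule: less_induct)
    case less
    have "(\<Sum>j\<in>{1..<n}. if p j = i then lookup b j else 0) = (\<Sum>j\<in>{1..<n}. if p j = i then lookup b' j else 0)"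
    proof (rule sum.cong)
      fix j assume j: "j \<in> {1..<n}"
      show "(if p j = i then lookup b j else 0) = (if p j = i then lookup b' j else 0)"
        using less.hyps[of j] parent[of j] j less.prems by auto
    qed simp
    then have "lookup a (x i) + lookup b' i = lookup a' (x i) + lookup b i"
      using bal[of i] incidence_split[of i b] incidence_split[of i b'] less.prems by simp
    then show ?case using nf[of i] nf'[of i] less.prems by linarith
  qed
  have E: "{1..<n} = insert 1 L" using n by auto
  have "(\<Sum>j\<in>{1..<n}. lookup c j) = lookup c 1 + (\<Sum>j\<in>L. lookup c j)" for c :: "nat \<Rightarrow>\<^sub>0 nat"
    unfolding E by simp
  then have "lookup b 1 + (\<Sum>j\<in>L. lookup b j) = lookup b' 1 + (\<Sum>j\<in>L. lookup b' j)"
    using b by (simp add: Mon_def)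
  then have 1: "lookup b 1 = lookup b' 1" using L by simp
  show ?thesis
  proof (rule poly_mapping_eqI)
    fix j show "lookup b j = lookup b' j"
    proof (cases "j \<in> {1..<n}")
      case True then show ?thesis using L 1 by (cases "j = 1") auto
    next
      case False then show ?thesis using b by (metis (mono_tags, lifting) Mon_def in_keys_iff mem_Collect_eq subsetD)
    qed
  qed
qed

text \<open>The substitution of the generators of the ideal for the variables \<open>Y\<close>, on forms of degree \<open>s\<close>.\<close>

definition augment :: "('v, 'k::field) rees \<Rightarrow> ('v, 'k) mpoly" where
  "augment z = (\<Sum>b\<in>Mon s. Gen b * lookup z b)"

lemma augment_add: "augment (y + z) = augment y + augment z"
  by (simp add: augment_def lookup_add distrib_left sum.distrib)

lemmas augment_sum = additive_map_sum(1)[of augment, OF augment_add]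
lemmas augment_diff = additive_map_sum(4)[of augment, OF augment_add]

lemma augment_YX_mult:
  assumes j: "j \<in> {1..<n}"
  shows "augment (YX j v * z) = Var v * gen j * (\<Sum>b\<in>Mon (s - 1). Gen b * lookup z b)"
proof -
  let ?\<epsilon> = "Poly_Mapping.single j 1 :: nat \<Rightarrow>\<^sub>0 nat"
  have "{b \<in> Mon s. lookup b j \<noteq> 0} = (\<lambda>b. b + ?\<epsilon>) ` Mon (s - 1)"
  proof (intro equalityI subsetI)
    fix b assume b: "b \<in> {b \<in> Mon s. lookup b j \<noteq> 0}"
    then have "b = (b - ?\<epsilon>) + ?\<epsilon>" using split_off_variable[of b j] by (simp add: add.commute)
    then show "b \<in> (\<lambda>b. b + ?\<epsilon>) ` Mon (s - 1)" using b Mon_add_single[OF j, of "b - ?\<epsilon>" s] by auto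
  next
    fix b assume "b \<in> (\<lambda>b. b + ?\<epsilon>) ` Mon (s - 1)"
    then obtain b' where "b = b' + ?\<epsilon>" "b' \<in> Mon (s - 1)" by blast
    then show "b \<in> {b \<in> Mon s. lookup b j \<noteq> 0}"
      using Mon_add_single[OF j, of b' s] s by (auto simp: lookup_add)
  qed
  moreover have "inj_on (\<lambda>b. b + ?\<epsilon>) (Mon (s - 1))" by (auto intro: inj_onI)
  ultimately have r: "(\<Sum>b\<in>{b \<in> Mon s. lookup b j \<noteq> 0}. g b) = (\<Sum>b\<in>Mon (s - 1). g (b + ?\<epsilon>))"
    for g :: "_ \<Rightarrow> ('v, 'b::field) mpoly" by (simp add: sum.reindex)
  have "augment (YX j v * z) = (\<Sum>b\<in>{b \<in> Mon s. lookup b j \<noteq> 0}. Gen b * (Var v * lookup z (b - ?\<epsilon>)))"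
    unfolding augment_def by (rule sum.mono_neutral_cong_right) (auto simp: lookup_YX_mult finite_Mon)
  also have "\<dots> = (\<Sum>b\<in>Mon (s - 1). Gen (b + ?\<epsilon>) * (Var v * lookup z b))"
    by (simp only: r add_diff_cancel_right')
  also have "\<dots> = Var v * gen j * (\<Sum>b\<in>Mon (s - 1). Gen b * lookup z b)"
    unfolding Gen_add_single[OF j] by (simp add: sum_distrib_left mult_ac)
  finally show ?thesis .
qed

lemma Var_gen:
  assumes "j \<in> {1..<n}"
  shows "Var (x j) * gen j = (\<Prod>v\<in>UNIV - {x (p j)}. Var v)" "Var (x (p j)) * gen j = (\<Prod>v\<in>UNIV - {x j}. Var v)"
proof -
  have ne: "x j \<noteq> x (p j)" using assms parent[of j] x_neq[of j "p j"] by auto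
  have "UNIV - {x (p j)} = insert (x j) (UNIV - {x j, x (p j)})" 
    "UNIV - {x j} = insert (x (p j)) (UNIV - {x j, x (p j)})" using ne by auto
  then show "Var (x j) * gen j = (\<Prod>v\<in>UNIV - {x (p j)}. Var v)" "Var (x (p j)) * gen j = (\<Prod>v\<in>UNIV - {x j}. Var v)"
    using ne by (simp_all add: gen_def)
qed

text \<open>Adjacent edges \<open>{u, v}\<close> and \<open>{u, w}\<close> satisfy \<open>X\<^sub>v m\<^sub>u\<^sub>v = X\<^sub>w m\<^sub>u\<^sub>w\<close>: both are the product of all variables
  except \<open>X\<^sub>u\<close>.\<close>

lemma augment_F_mult:
  fixes z :: "('v, 'k::field) rees"
  assumes j: "j \<in> L"
  shows "augment (F j * z) = 0"
proof -
  have V1: "Var (x i) * gen i = (\<Prod>v\<in>UNIV - {x (p i)}. Var v :: ('v, 'k) mpoly)" if "i \<in> {1..<n}" for i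
    by (rule Var_gen(1)[OF that])
  have V2: "Var (x (p i)) * gen i = (\<Prod>v\<in>UNIV - {x i}. Var v :: ('v, 'k) mpoly)" if "i \<in> {1..<n}" for i
    by (rule Var_gen(2)[OF that])
  have pj: "p j < j" using j parent[of j] by auto
  have eq: "Var (x j) * gen j = Var (x (if p j = 0 then 1 else p (p j))) *
      (gen (if p j = 0 then 1 else p j) :: ('v, 'k) mpoly)"
  proof (cases "p j = 0")
    case True
    \<comment> \<open>The edge that attaches \<open>x j\<close> and the edge numbered \<open>1\<close> meet in the root.\<close>
    have "p 1 = 0" using parent[of 1] n by simp
    then show ?thesis using True V1[of j] V1[of 1] j by auto
  next
    case False
    then show ?thesis using False V1[of j] V2[of "p j"] j pj by auto
  qed
  have q: "(if p j = 0 then 1 else p j) \<in> {1..<n}" and j1: "j \<in> {1..<n}" using j pj by auto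
  show ?thesis
    unfolding F_def C_def left_diff_distrib augment_diff augment_YX_mult[OF q] augment_YX_mult[OF j1] eq
    by simp
qed

text \<open>Distinct normal monomials have distinct images, so no cancellation can occur among them.\<close>

lemma augment_normal_eq_0:
  assumes z: "z \<in> G 0" and nf: "\<And>j. j \<in> L \<Longrightarrow> YX_quotient j (x j) z = 0" and 0: "augment z = 0"
  shows "z = 0"
proof (rule ccontr)
  have normal: "lookup b j = 0 \<or> lookup a (x j) = 0" if "j \<in> L" "lookup (lookup z b) a \<noteq> 0" for a b j
  proof (rule ccontr)
    assume "\<not> ?thesis"
    then have ba: "b = (b - Poly_Mapping.single j 1) + Poly_Mapping.single j 1"
      "a = (a - Poly_Mapping.single (x j) 1) + Poly_Mapping.single (x j) 1"
      using split_off_variable[of b j] split_off_variable[of a "x j"] by (simp_all add: add.commute)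
    have "lookup (lookup (YX_quotient j (x j) z) (b - Poly_Mapping.single j 1)) (a - Poly_Mapping.single (x j) 1) =
      lookup (lookup z b) a"
      unfolding lookup_YX_quotient lookup_monomial_quotient ba[symmetric] ..
    then show False using nf[OF that(1)] that(2) by simp
  qed
  assume "z \<noteq> 0"
  then obtain b where "lookup z b \<noteq> 0" by (metis lookup_zero poly_mapping_eqI)
  then obtain a where a: "lookup (lookup z b) a \<noteq> 0" by (metis lookup_zero poly_mapping_eqI)
  have Mon: "b \<in> Mon s" if "lookup (lookup z b) a \<noteq> 0" for a b
  proof -
    have "lookup z b \<noteq> 0" using that by auto
    then show ?thesis using z by (simp add: G_def)
  qed
  have "lookup (Gen b' * lookup z b') (expo b + a) = 0" if "b' \<in> Mon s" "b' \<noteq> b" for b'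
  proof (cases "\<exists>a'. expo b + a = expo b' + a'")
    case True
    then obtain a' where a': "expo b + a = expo b' + a'" by blast
    have "lookup (lookup z b') a' = 0"
    proof (rule ccontr)
      assume "lookup (lookup z b') a' \<noteq> 0"
      then have "b = b'"
        by (intro normal_monomials_distinct[OF Mon[OF a] that(1)] normal) (use a' a in \<open>auto simp: add.commute\<close>)
      then show False using that by simp
    qed
    then show ?thesis unfolding a' Gen_eq_single by (simp add: lookup_single_mult_add)
  next
    case False
    then show ?thesis unfolding Gen_eq_single by (intro lookup_single_mult_eq_0) auto
  qed
  then have "lookup (augment z) (expo b + a) = (\<Sum>b'\<in>Mon s. if b' = b then lookup (Gen b * lookup z b) (expo b + a) else 0)"
    unfolding augment_def lookup_sum by (intro sum.cong) auto
  also have "\<dots> = lookup (lookup z b) a"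
    using Mon[OF a] finite_Mon by (simp add: Gen_eq_single lookup_single_mult_add)
  finally show False using a 0 by simp
qed

text \<open>The elements \<open>F v\<close> generate all relations: division reduces every form, modulo them, to a
  combination of normal monomials.\<close>

lemma augment_kernel:
  assumes z: "z \<in> G 0" and 0: "augment z = 0"
  obtains y where "\<And>v. y v \<in> G 1" "z = (\<Sum>v\<in>L. F v * y v)"
proof -
  have "\<exists>y. (\<forall>v. y v \<in> G 1) \<and> (\<forall>m\<in>L. m \<in> L \<and> YX_quotient m (x m) (z - (\<Sum>v\<in>L. F v * y v)) = 0) \<and>
    (\<forall>m. (\<forall>u\<in>L. u < m) \<longrightarrow> m \<in> L \<and> YX_quotient m (x m) z = 0 \<longrightarrow> m \<in> L \<and> YX_quotient m (x m) (z - (\<Sum>v\<in>L. F v * y v)) = 0)"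
    by (rule koszul_division.koszul_normal_form[OF koszul_division_F,
          where N = "\<lambda>m z. m \<in> L \<and> YX_quotient m (x m) z = 0"])
      (auto intro: F_mult_G H_G Q_remainder Q_remainder_less z)
  then obtain y where y: "\<And>v. y v \<in> G 1" "\<And>m. m \<in> L \<Longrightarrow> YX_quotient m (x m) (z - (\<Sum>v\<in>L. F v * y v)) = 0"
    by blast
  have "(\<Sum>v\<in>L. F v * y v) \<in> G 0" using y(1) by (intro G_sum F_mult_G) auto
  then have "z - (\<Sum>v\<in>L. F v * y v) \<in> G 0"
    using koszul_division.G_diff[OF koszul_division_F z] by blast
  moreover have "augment (z - (\<Sum>v\<in>L. F v * y v)) = 0"
    unfolding augment_diff augment_sum using 0 by (simp add: augment_F_mult)
  ultimately have "z - (\<Sum>v\<in>L. F v * y v) = 0" using augment_normal_eq_0 y(2) by blast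
  then show ?thesis by (intro that[of y]) (use y(1) in simp_all)
qed

end

section \<open>Powers of the ideal\<close>

lemma module_self: "Modules.module ((*) :: 'a::comm_ring_1 \<Rightarrow> 'a \<Rightarrow> 'a)"
  by unfold_locales (simp_all add: algebra_simps)

lemmas ideal_gen_zero = Modules.module.span_zero[OF module_self, folded ideal_gen_def]
  and ideal_gen_add = Modules.module.span_add[OF module_self, folded ideal_gen_def]
  and ideal_gen_mult = Modules.module.span_scale[OF module_self, folded ideal_gen_def]
  and ideal_gen_base = Modules.module.span_base[OF module_self, folded ideal_gen_def]
  and ideal_gen_sum = Modules.module.span_sum[OF module_self, folded ideal_gen_def]
  and ideal_gen_mono = Modules.module.span_mono[OF module_self, folded ideal_gen_def]
  and ideal_gen_minimal = Modules.module.span_minimal[OF module_self, folded ideal_gen_def]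
  and ideal_gen_induct = Modules.module.span_induct_alt[OF module_self, folded ideal_gen_def,
    consumes 1, case_names base step]
  and ideal_subspace_def = Modules.module.subspace_def[OF module_self]
  and ideal_gen_subspace = Modules.module.subspace_span[OF module_self, folded ideal_gen_def]

text \<open>A family rather than a set of generators, so that a coefficient vector is indexed by the family
  even if members of it coincide.\<close>

lemma ideal_gen_image:
  fixes f :: "'b \<Rightarrow> 'a::comm_ring_1"
  assumes "finite X"
  shows "ideal_gen (f ` X) = {\<Sum>x\<in>X. f x * g x | g. True}"
proof (rule equalityI)
  let ?I = "{\<Sum>x\<in>X. f x * g x | g. True}"
  show "ideal_gen (f ` X) \<subseteq> ?I"
  proof (rule ideal_gen_minimal)
    show "f ` X \<subseteq> ?I"
    proof clarify
      fix y assume "y \<in> X"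
      then have "(\<Sum>x\<in>X. f x * (if x = y then 1 else 0)) = f y"
        using assms by (simp add: if_distrib[of "(*) _"] cong: if_cong)
      then show "\<exists>g. f y = (\<Sum>x\<in>X. f x * g x) \<and> True"
        by (intro exI[of _ "\<lambda>x. if x = y then 1 else 0"]) simp
    qed
    show "Modules.module.subspace (*) ?I"
      unfolding ideal_subspace_def
    proof (intro conjI ballI allI)
      have "0 = (\<Sum>x\<in>X. f x * 0)" by simp
      then show "0 \<in> ?I" by (intro CollectI exI[of _ "\<lambda>_. 0"] conjI TrueI)
      fix a assume "a \<in> ?I"
      then obtain g where a: "a = (\<Sum>x\<in>X. f x * g x)" by blast
      show "c * a \<in> ?I" for c
      proof -
        have "c * a = (\<Sum>x\<in>X. f x * (c * g x))" unfolding a sum_distrib_left by (simp only: mult.left_commute)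
        then show ?thesis by (intro CollectI exI conjI TrueI)
      qed
      fix b assume "b \<in> ?I"
      then obtain h where b: "b = (\<Sum>x\<in>X. f x * h x)" by blast
      have "a + b = (\<Sum>x\<in>X. f x * (g x + h x))" unfolding a b by (simp only: sum.distrib distrib_left)
      then show "a + b \<in> ?I" by (intro CollectI exI conjI TrueI)
    qed
  qed
  show "?I \<subseteq> ideal_gen (f ` X)"
  proof clarify
    fix g
    have "f x * g x \<in> ideal_gen (f ` X)" if "x \<in> X" for x
      using ideal_gen_mult[OF ideal_gen_base[OF imageI[OF that, of f]], of "g x"] by (simp add: mult.commute)
    then show "(\<Sum>x\<in>X. f x * g x) \<in> ideal_gen (f ` X)" by (rule ideal_gen_sum)
  qed
qed

lemma ideal_mult_gen:
  fixes P Q :: "'a::comm_ring_1 set"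
  shows "ideal_mult (ideal_gen P) (ideal_gen Q) = ideal_gen {p * q | p q. p \<in> P \<and> q \<in> Q}"
proof -
  define PQ where "PQ = {p * q | p q. p \<in> P \<and> q \<in> Q}"
  have PQ: "p * q \<in> ideal_gen PQ" if "p \<in> P" "q \<in> Q" for p q
    by (rule ideal_gen_base) (use that in \<open>auto simp: PQ_def\<close>)
  have 1: "p * b \<in> ideal_gen PQ" if "p \<in> P" "b \<in> ideal_gen Q" for p b
    using that(2)
  proof (induction b rule: ideal_gen_induct)
    case base then show ?case by (simp add: ideal_gen_zero)
  next
    case (step c q b)
    have "p * (c * q + b) = c * (p * q) + p * b" by (simp add: algebra_simps)
    then show ?case using ideal_gen_add[OF ideal_gen_mult[OF PQ[OF that(1) step(1)]] step(2), of c] by simp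
  qed
  have 2: "a * b \<in> ideal_gen PQ" if "a \<in> ideal_gen P" "b \<in> ideal_gen Q" for a b
    using that(1)
  proof (induction a rule: ideal_gen_induct)
    case base then show ?case by (simp add: ideal_gen_zero)
  next
    case (step c p a)
    have "(c * p + a) * b = c * (p * b) + a * b" by (simp add: algebra_simps)
    then show ?case using ideal_gen_add[OF ideal_gen_mult[OF 1[OF step(1) that(2)]] step(2), of c] by simp
  qed
  have "ideal_gen {a * b | a b. a \<in> ideal_gen P \<and> b \<in> ideal_gen Q} \<subseteq> ideal_gen PQ"
    by (rule ideal_gen_minimal) (use 2 ideal_gen_subspace in auto)
  moreover have "ideal_gen PQ \<subseteq> ideal_gen {a * b | a b. a \<in> ideal_gen P \<and> b \<in> ideal_gen Q}"
    unfolding PQ_def by (rule ideal_gen_mono) (use ideal_gen_base in blast)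
  ultimately show ?thesis unfolding ideal_mult_def PQ_def[symmetric] by (rule equalityI)
qed

context tree_order
begin

text \<open>Stars and bars: an exponent vector is a list of \<open>n - 1\<close> numbers with sum \<open>t\<close>.\<close>

lemma card_Mon:
  "card (Mon t) = (t + n - 2) choose (n - 2)"
proof -
  let ?M = "Mon t" and ?l = "\<lambda>b. map (lookup b) [1..<n]"
  have Mon: "b \<in> ?M \<longleftrightarrow> keys b \<subseteq> {1..<n} \<and> (\<Sum>j\<in>{1..<n}. lookup b j) = t" for b
    by (simp add: Mon_def)
  have sum_l: "sum_list (?l b) = (\<Sum>j\<in>{1..<n}. lookup b j)" for b
    by (simp only: interv_sum_list_conv_sum_set_nat set_upt)
  have "bij_betw ?l ?M {l. length l = n - 1 \<and> sum_list l = t}"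
    unfolding bij_betw_def
  proof (intro conjI equalityI subsetI inj_onI)
    fix b b' assume b: "b \<in> ?M" "b' \<in> ?M" and eq: "?l b = ?l b'"
    show "b = b'"
    proof (rule poly_mapping_eqI)
      fix j show "lookup b j = lookup b' j"
      proof (cases "j \<in> {1..<n}")
        case True then show ?thesis using eq by simp
      next
        case False then show ?thesis using b by (metis Mon in_keys_iff subsetD)
      qed
    qed
  next
    fix l assume "l \<in> ?l ` ?M"
    then show "l \<in> {l. length l = n - 1 \<and> sum_list l = t}"
      using sum_l by (auto simp only: Mon mem_Collect_eq length_map length_upt)
  next
    fix l :: "nat list" assume l: "l \<in> {l. length l = n - 1 \<and> sum_list l = t}"
    define b where "b = Abs_poly_mapping (\<lambda>j. if j \<in> {1..<n} then l ! (j - 1) else 0)"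
    have b: "lookup b j = (if j \<in> {1..<n} then l ! (j - 1) else 0)" for j
      unfolding b_def by (subst lookup_Abs_poly_mapping) (auto intro: finite_subset[of _ "{1..<n}"])
    have lb: "?l b = l" by (rule nth_equalityI) (use l in \<open>auto simp: b\<close>)
    moreover have "b \<in> ?M"
      unfolding Mon sum_l[symmetric] lb using l by (auto simp: in_keys_iff b split: if_splits)
    ultimately show "l \<in> ?l ` ?M" by force
  qed
  then have "card ?M = card {l :: nat list. length l = n - 1 \<and> sum_list l = t}" by (rule bij_betw_same_card)
  also have "\<dots> = (t + (n - 1) - 1) choose t" by (rule card_length_sum_list)
  also have "\<dots> = (t + n - 2) choose (n - 2)"
  proof -
    obtain m where "n = 2 + m" using n le_Suc_ex by blast
    then show ?thesis using binomial_symmetric[of t "t + m"] by simp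
  qed
  finally show ?thesis .
qed


lemma Gen_Mon_Suc: "{p * q | p q. p \<in> gen ` {1..<n} \<and> q \<in> Gen ` Mon t} = Gen ` Mon (Suc t)"
proof (intro equalityI subsetI)
  fix a assume "a \<in> {p * q | p q. p \<in> gen ` {1..<n} \<and> q \<in> Gen ` Mon t}"
  then obtain j b where "j \<in> {1..<n}" "b \<in> Mon t" "a = gen j * Gen b" by blast
  then show "a \<in> Gen ` Mon (Suc t)"
    using Gen_add_single[of j b] Mon_add_single[of j b "Suc t"] by (metis diff_Suc_1 image_eqI nat.distinct(1))
next
  fix a assume "a \<in> Gen ` Mon (Suc t)"
  then obtain b where b: "b \<in> Mon (Suc t)" "a = Gen b" by blast
  then have "(\<Sum>j\<in>{1..<n}. lookup b j) \<noteq> 0" by (simp add: Mon_def)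
  then obtain j where j: "j \<in> {1..<n}" "lookup b j \<noteq> 0" by (meson sum.neutral)
  define b' where "b' = b - Poly_Mapping.single j 1"
  have bb: "b = b' + Poly_Mapping.single j 1"
    using split_off_variable[OF j(2)] by (simp add: b'_def add.commute)
  then have "b' \<in> Mon t" using b(1) Mon_add_single[OF j(1), of b' "Suc t"] by simp
  then show "a \<in> {p * q | p q. p \<in> gen ` {1..<n} \<and> q \<in> Gen ` Mon t}"
    unfolding b(2) bb Gen_add_single[OF j(1)] using j(1) by blast
qed

lemma ideal_power_gen:
  "(ideal_power (ideal_gen (gen ` {1..<n})) t :: ('v, 'k::field) mpoly set) = ideal_gen (Gen ` Mon t)"
proof (induction t)
  case 0
  have "Mon 0 = {0}"
    by (auto simp: Mon_def in_keys_iff intro!: poly_mapping_eqI)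
  then have "(ideal_gen (Gen ` Mon 0) :: ('v, 'k) mpoly set) = UNIV"
    by (subst ideal_gen_image) (auto simp: Gen_0)
  then show ?case by simp
next
  case (Suc t)
  then show ?case by (simp only: ideal_power.simps ideal_mult_gen Gen_Mon_Suc)
qed

lemma basis_0: "basis 0 = (\<lambda>b. ({}, b)) ` Mon s"
  by (auto simp: basis_def finite_subset[of _ L])

lemma sum_basis_0: "(\<Sum>\<beta>\<in>basis 0. Gen (snd \<beta>) * g \<beta>) = (\<Sum>b\<in>Mon s. Gen b * g ({}, b))"
  unfolding basis_0 by (subst sum.reindex) (auto intro: inj_onI)

lemma augment_of_coeffs: "augment (of_coeffs 0 g {}) = (\<Sum>\<beta>\<in>basis 0. Gen (snd \<beta>) * g \<beta>)"
  unfolding sum_basis_0 augment_def by (rule sum.cong) (auto simp: lookup_of_coeffs basis_0)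

lemma koszul_singletons: "koszul F L z {} = (\<Sum>v\<in>L. F v * z {v})"
  by (simp add: koszul_def)

lemma exact_augment:
  "(\<Sum>\<beta>\<in>basis 0. Gen (snd \<beta>) * g \<beta>) = 0 \<longleftrightarrow>
   (\<exists>h. \<forall>\<beta>\<in>basis 0. g \<beta> = (\<Sum>\<gamma>\<in>basis 1. entry 0 \<beta> \<gamma> * h \<gamma>))"
proof
  assume "(\<Sum>\<beta>\<in>basis 0. Gen (snd \<beta>) * g \<beta>) = 0"
  then have aug: "augment (of_coeffs 0 g {}) = 0" by (simp add: augment_of_coeffs)
  have "of_coeffs 0 g {} \<in> G (card ({} :: nat set))" using of_coeffs_strand[of 0 g] unfolding strand_def by blast
  then have G0: "of_coeffs 0 g {} \<in> G 0" by simp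
  obtain y where y: "\<And>v. y v \<in> G 1" "of_coeffs 0 g {} = (\<Sum>v\<in>L. F v * y v)"
    by (rule augment_kernel[OF G0 aug]) (rule that)
  define z where "z A = (if A \<subseteq> L \<and> card A = 1 then y (the_elem A) else 0)" for A
  have "z \<in> strand 1" using y(1) by (auto simp: strand_def z_def G_0 simp flip: One_nat_def)
  moreover have "koszul F L z {} = of_coeffs 0 g {}"
    unfolding koszul_singletons y(2) by (rule sum.cong) (auto simp: z_def)
  ultimately have z: "z \<in> strand 1" "koszul F L z {} = of_coeffs 0 g {}" by blast+
  show "\<exists>h. \<forall>\<beta>\<in>basis 0. g \<beta> = (\<Sum>\<gamma>\<in>basis 1. entry 0 \<beta> \<gamma> * h \<gamma>)"
  proof (intro exI ballI)
    fix \<beta> assume \<beta>: "\<beta> \<in> basis 0"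
    then have "fst \<beta> = {}" by (auto simp: basis_0)
    then show "g \<beta> = (\<Sum>\<gamma>\<in>basis 1. entry 0 \<beta> \<gamma> * (\<lambda>(A, b). lookup (z A) b) \<gamma>)"
      unfolding sum_entry of_coeffs_lookup[OF z(1)] using z(2) \<beta> lookup_of_coeffs[of 0 g "{}" "snd \<beta>"]
      by (metis prod.collapse)
  qed
next
  assume "\<exists>h. \<forall>\<beta>\<in>basis 0. g \<beta> = (\<Sum>\<gamma>\<in>basis 1. entry 0 \<beta> \<gamma> * h \<gamma>)"
  then obtain h where h: "\<And>\<beta>. \<beta> \<in> basis 0 \<Longrightarrow> g \<beta> = lookup (koszul F L (of_coeffs 1 h) (fst \<beta>)) (snd \<beta>)"
    unfolding sum_entry by blast
  have "of_coeffs 0 g = koszul F L (of_coeffs 1 h)"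
    by (rule strand_eqI[OF of_coeffs_strand koszul_strand]) (use of_coeffs_strand[of 1 h] in \<open>auto simp: lookup_of_coeffs h\<close>)
  then have "augment (of_coeffs 0 g {}) = 0"
    by (simp add: koszul_singletons augment_sum augment_F_mult)
  then show "(\<Sum>\<beta>\<in>basis 0. Gen (snd \<beta>) * g \<beta>) = 0" by (simp add: augment_of_coeffs)
qed

text \<open>Exactness is \<open>exact_strand\<close> in positive degrees and \<open>exact_augment\<close> at the start; the image of the
  augmentation is the power of the ideal because products of \<open>s\<close> generators generate it.\<close>

theorem minimal_resolution:
  obtains d :: "nat \<Rightarrow> ('v, 'k::field) mpoly mat" where
    "free_resolution (ideal_power (ideal_gen (gen ` {1..<n})) s) (\<lambda>i. card (basis i)) d"
    "\<And>i. map_mat residue (d (Suc i)) = 0\<^sub>m (card (basis i)) (card (basis (Suc i)))"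
proof -
  have image: "{\<Sum>\<beta>\<in>basis 0. Gen (snd \<beta>) * g \<beta> | g. True} =
    (ideal_power (ideal_gen (gen ` {1..<n})) s :: ('v, 'k) mpoly set)"
  proof -
    have "(ideal_power (ideal_gen (gen ` {1..<n})) s :: ('v, 'k) mpoly set) =
        ideal_gen ((\<lambda>\<beta>. Gen (snd \<beta>)) ` basis 0)"
      unfolding ideal_power_gen basis_0 by (simp add: image_image)
    then show ?thesis unfolding ideal_gen_image[OF finite_basis] by (rule sym)
  qed
  obtain d :: "nat \<Rightarrow> ('v, 'k) mpoly mat" and e where
    d: "free_resolution (ideal_power (ideal_gen (gen ` {1..<n})) s) (\<lambda>i. card (basis i)) d" and
    ent: "\<And>i x y. x < card (basis i) \<Longrightarrow> y < card (basis (Suc i)) \<Longrightarrow> d (Suc i) $$ (x, y) = entry i (e i x) (e (Suc i) y)"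
    by (rule free_resolution_of_based_complex[OF finite_basis image exact_augment exact_strand]) (rule that)
  have "map_mat residue (d (Suc i)) = 0\<^sub>m (card (basis i)) (card (basis (Suc i)))" for i
    by (rule eq_matI) (use resolution_carrier(2)[OF d, of i] in \<open>auto simp: ent residue_entry\<close>)
  then show ?thesis using that d by blast
qed

lemma card_basis: "card (basis i) = (n - 2 choose i) * (n - 2 - i + s choose (n - 2))"
proof (cases "i \<le> s \<and> i \<le> n - 2")
  case True
  have "basis i = {A. A \<subseteq> L \<and> card A = i} \<times> Mon (s - i)" using True by (auto simp: basis_def)
  then have "card (basis i) = (card L choose i) * card (Mon (s - i))"
    by (simp add: card_cartesian_product n_subsets)
  also have "card (Mon (s - i)) = (s - i + n - 2) choose (n - 2)" using card_Mon by simp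
  also have "s - i + n - 2 = n - 2 - i + s" using True n by arith
  finally show ?thesis by simp
next
  case False
  have "basis i = {}"
  proof (cases "i \<le> s")
    case True
    have "card L < i" using True False by simp
    show ?thesis
    proof (rule equals0I)
      fix \<beta> assume "\<beta> \<in> basis i"
      then have "fst \<beta> \<subseteq> L" "card (fst \<beta>) = i" by (auto simp: basis_def)
      then show False using card_mono[of L "fst \<beta>"] \<open>card L < i\<close> by simp
    qed
  qed (auto simp: basis_def)
  moreover have "(n - 2 choose i) * (n - 2 - i + s choose (n - 2)) = 0"
    using False by (cases "i \<le> n - 2") simp_all
  ultimately show ?thesis by simp
qed

theorem betti_ideal_power:
  "betti (ideal_power (ideal_gen (gen ` {1..<n} :: ('v, 'k::field) mpoly set)) s) i =
    (n - 2 choose i) * (n - 2 - i + s choose (n - 2))"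
proof -
  let ?I = "ideal_power (ideal_gen (gen ` {1..<n} :: ('v, 'k) mpoly set)) s"
  obtain d where d: "free_resolution ?I (\<lambda>i. card (basis i)) d"
    "\<And>i. map_mat residue (d (Suc i)) = 0\<^sub>m (card (basis i)) (card (basis (Suc i)))"
    by (rule minimal_resolution) (rule that)
  define rd where "rd = (SOME (r, d). free_resolution ?I r d)"
  obtain r' d' where rd: "rd = (r', d')" by (cases rd)
  have "case rd of (r, d) \<Rightarrow> free_resolution ?I r d"
    unfolding rd_def by (rule someI[of _ "(\<lambda>i. card (basis i), d)"]) (simp only: prod.case d(1))
  then have "free_resolution ?I r' d'" by (simp add: rd)
  from homology_of_reduced_resolution[OF semiring_hom_residue this d, of i]
  have "homology_dim r' d' i = card (basis i)" by (auto simp: homology_dim_def split: if_splits)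
  moreover have "betti ?I i = homology_dim r' d' i"
    using rd by (simp add: betti_def Let_def rd_def)
  ultimately show ?thesis by (simp add: card_basis)
qed

end

section \<open>Trees and their cliques\<close>

definition connecting_path :: "'v graph \<Rightarrow> 'v set \<Rightarrow> 'v \<Rightarrow> 'v \<Rightarrow> 'v list \<Rightarrow> bool" where
  "connecting_path T U a b ws \<longleftrightarrow> ws \<noteq> [] \<and> hd ws = a \<and> last ws = b \<and> distinct ws \<and> set ws \<subseteq> U \<and>
     successively (\<lambda>u v. {u, v} \<in> T) ws"

text \<open>A second neighbour would close the path to a cycle through \<open>v\<close>.\<close>

lemma connecting_path_no_second_neighbour:
  assumes T: "is_tree T" and ws: "connecting_path T U a b ws" and v: "v \<notin> U"
    and av: "{a, v} \<in> T" and bv: "{b, v} \<in> T"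
  shows "a = b"
proof (rule ccontr)
  assume "a \<noteq> b"
  have ws': "ws \<noteq> []" "hd ws = a" "last ws = b" "distinct ws" "set ws \<subseteq> U" "successively (\<lambda>u v. {u, v} \<in> T) ws"
    using ws by (simp_all add: connecting_path_def)
  have len: "length ws \<ge> 2"
  proof (rule ccontr)
    assume "\<not> length ws \<ge> 2"
    then obtain w where "ws = [w]" using ws'(1) by (cases ws; cases "tl ws") auto
    then show False using ws' \<open>a \<noteq> b\<close> by simp
  qed
  have "graph_cycle T (ws @ [v])"
    unfolding graph_cycle_def
  proof (intro conjI allI impI)
    show "distinct (ws @ [v])" using ws' v by auto
    fix j assume "j < length (ws @ [v])"
    then consider "Suc j < length ws" | "Suc j = length ws" | "j = length ws" by fastforce
    then show "{(ws @ [v]) ! j, (ws @ [v]) ! (Suc j mod length (ws @ [v]))} \<in> T"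
    proof cases
      case 1
      then show ?thesis using ws'(6) by (simp add: successively_conv_nth nth_append)
    next
      case 2
      then have "ws ! j = b" using ws'(1,3) by (metis diff_Suc_1 last_conv_nth)
      then show ?thesis using 2 bv by (simp add: nth_append)
    next
      case 3
      then show ?thesis using ws'(1,2) av by (simp add: nth_append hd_conv_nth insert_commute)
    qed
  qed (use len in simp)
  then show False using T by (auto simp: is_tree_def)
qed

lemma connected_boundary_edge:
  assumes T: "graph_connected T" and U: "u0 \<in> U" "U \<noteq> UNIV"
  obtains u v where "u \<in> U" "v \<notin> U" "{u, v} \<in> T"
proof -
  obtain z where z: "z \<notin> U" using U by auto
  have "(u0, z) \<in> {(x, y). {x, y} \<in> T}\<^sup>*" using T by (simp add: graph_connected_def)
  then have "z \<in> U" if "\<And>u v. u \<in> U \<Longrightarrow> {u, v} \<in> T \<Longrightarrow> v \<in> U"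
    by (induction rule: rtrancl_induct) (use U that in auto)
  then show ?thesis using z that by blast
qed

text \<open>Grow a connected set of vertices one at a time. Connectedness supplies an edge that leaves the set;
  acyclicity makes it the only edge from the new vertex back into the set, because paths inside the
  set join any two of its vertices.\<close>

lemma tree_growth:
  fixes T :: "'v::finite graph"
  assumes T: "is_tree T" and m: "1 \<le> m" "m \<le> card (UNIV :: 'v set)"
  shows "\<exists>x p. inj_on x {..<m} \<and> (\<forall>j. 1 \<le> j \<longrightarrow> j < m \<longrightarrow> p j < j) \<and>
    {e \<in> T. e \<subseteq> x ` {..<m}} = {{x j, x (p j)} | j. 1 \<le> j \<and> j < m} \<and>
    (\<forall>a\<in>x ` {..<m}. \<forall>b\<in>x ` {..<m}. \<exists>ws. connecting_path T (x ` {..<m}) a b ws)"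
  using m
proof (induction m rule: dec_induct)
  case base
  have "e \<notin> T" if "e \<subseteq> {u}" for e and u :: 'v
  proof
    assume "e \<in> T"
    then have "card e = 2" using T by (simp add: is_tree_def simple_graph_def)
    then show False using card_mono[OF _ that] by simp
  qed
  moreover have "connecting_path T {u} u u [u]" for u by (simp add: connecting_path_def)
  ultimately show ?case
    by (intro exI[of _ "\<lambda>_. undefined"] exI[of _ id]) (auto simp: lessThan_Suc)
next
  case (step m)
  have "m \<le> card (UNIV :: 'v set)" using step.prems by simp
  from step.IH[OF this] obtain x p where inj: "inj_on x {..<m}" and p: "\<forall>j. 1 \<le> j \<longrightarrow> j < m \<longrightarrow> p j < j"
    and edges: "{e \<in> T. e \<subseteq> x ` {..<m}} = {{x j, x (p j)} | j. 1 \<le> j \<and> j < m}"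
    and paths: "\<forall>a\<in>x ` {..<m}. \<forall>b\<in>x ` {..<m}. \<exists>ws. connecting_path T (x ` {..<m}) a b ws"
    by (elim exE conjE) (rule that)
  let ?U = "x ` {..<m}"
  have "card ?U = m" using inj by (simp add: card_image)
  then have "?U \<noteq> UNIV" using step.prems by auto
  moreover have "x 0 \<in> ?U" using step.hyps by auto
  ultimately obtain u v where uv: "u \<in> ?U" "v \<notin> ?U" "{u, v} \<in> T"
    using connected_boundary_edge[of T "x 0" ?U] T by (auto simp: is_tree_def)
  then obtain k where k: "k < m" "u = x k" by auto
  define x' where "x' = x(m := v)"
  define p' where "p' = p(m := k)"
  have x'_img: "x' ` {..<Suc m} = insert v ?U" by (auto simp: x'_def lessThan_Suc)
  have inj': "inj_on x' {..<Suc m}"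
    using inj uv(2) by (auto simp: x'_def lessThan_Suc inj_on_def)
  have parent: "\<forall>j. 1 \<le> j \<longrightarrow> j < Suc m \<longrightarrow> p' j < j" using p k by (auto simp: p'_def less_Suc_eq)
  have edges': "{e \<in> T. e \<subseteq> x' ` {..<Suc m}} = {{x' j, x' (p' j)} | j. 1 \<le> j \<and> j < Suc m}"
  proof -
    have "e = {v, u}" if e: "e \<in> T" "e \<subseteq> insert v ?U" "v \<in> e" for e
    proof -
      have "card e = 2" using T e by (simp add: is_tree_def simple_graph_def)
      then obtain u' where u': "e = {v, u'}" "u' \<noteq> v" using e(3) by (auto simp: card_2_iff)
      then have "u' \<in> ?U" using e by auto
      then obtain ws where "connecting_path T ?U u u' ws" using paths uv(1) by blast
      then have "u = u'"
        using connecting_path_no_second_neighbour[OF T _ uv(2,3)] e(1) u' by (simp add: insert_commute)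
      then show ?thesis using u' by simp
    qed
    note new = this
    have "{e \<in> T. e \<subseteq> insert v ?U} = insert {v, u} {e \<in> T. e \<subseteq> ?U}"
    proof (intro equalityI subsetI)
      fix e assume e: "e \<in> {e \<in> T. e \<subseteq> insert v ?U}"
      show "e \<in> insert {v, u} {e \<in> T. e \<subseteq> ?U}"
      proof (cases "v \<in> e")
        case True then show ?thesis using new e by blast
      next
        case False then show ?thesis using e by blast
      qed
    next
      fix e assume e: "e \<in> insert {v, u} {e \<in> T. e \<subseteq> ?U}"
      have "{v, u} \<in> T" using uv(3) by (simp add: insert_commute)
      then show "e \<in> {e \<in> T. e \<subseteq> insert v ?U}" using e uv(1) by blast
    qed
    also have "\<dots> = insert {x' m, x' (p' m)} {{x j, x (p j)} | j. 1 \<le> j \<and> j < m}"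
      unfolding edges using k by (simp add: x'_def p'_def)
    also have "{{x j, x (p j)} | j. 1 \<le> j \<and> j < m} = {{x' j, x' (p' j)} | j. 1 \<le> j \<and> j < m}"
    proof -
      have "x' j = x j \<and> x' (p' j) = x (p j)" if "1 \<le> j" "j < m" for j
        using p that by (force simp: x'_def p'_def)
      then show ?thesis by (intro Collect_cong) metis
    qed
    also have "insert {x' m, x' (p' m)} {{x' j, x' (p' j)} | j. 1 \<le> j \<and> j < m} =
        {{x' j, x' (p' j)} | j. 1 \<le> j \<and> j < Suc m}"
      using step.hyps by (auto simp: less_Suc_eq)
    finally show ?thesis unfolding x'_img .
  qed
  have paths': "\<exists>ws. connecting_path T (x' ` {..<Suc m}) a b ws"
    if ab: "a \<in> x' ` {..<Suc m}" "b \<in> x' ` {..<Suc m}" for a b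
  proof -
    consider "a = v" "b = v" | "a \<in> ?U" "b \<in> ?U" | "a \<in> ?U" "b = v" | "a = v" "b \<in> ?U"
      using ab unfolding x'_img by blast
    then show ?thesis
      unfolding x'_img
    proof cases
      case 1
      then have "connecting_path T (insert v ?U) a b [v]" by (simp add: connecting_path_def)
      then show "\<exists>ws. connecting_path T (insert v ?U) a b ws" by blast
    next
      case 2
      then obtain ws where "connecting_path T ?U a b ws" using paths by blast
      then have "connecting_path T (insert v ?U) a b ws" by (auto simp: connecting_path_def)
      then show "\<exists>ws. connecting_path T (insert v ?U) a b ws" by blast
    next
      case 3
      then obtain ws where "connecting_path T ?U a u ws" using paths uv(1) by blast
      then have "connecting_path T (insert v ?U) a b (ws @ [v])"
        using 3 uv by (auto simp: connecting_path_def successively_append_iff)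
      then show "\<exists>ws. connecting_path T (insert v ?U) a b ws" by blast
    next
      case 4
      then obtain ws where "connecting_path T ?U u b ws" using paths uv(1) by blast
      then have "connecting_path T (insert v ?U) a b (v # ws)"
        using 4 uv by (cases ws) (auto simp: connecting_path_def insert_commute)
      then show "\<exists>ws. connecting_path T (insert v ?U) a b ws" by blast
    qed
  qed
  show ?case
    by (intro exI[of _ x'] exI[of _ p'] conjI ballI inj' parent edges' paths')
qed

lemma tree_leaf_order:
  fixes T :: "'v::finite graph"
  assumes T: "is_tree T" and n: "card (UNIV :: 'v set) = n"
  obtains x p where "bij_betw x {..<n} (UNIV :: 'v set)" "\<And>j. 1 \<le> j \<Longrightarrow> j < n \<Longrightarrow> p j < j"
    "T = {{x j, x (p j)} | j. 1 \<le> j \<and> j < n}"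
proof -
  have "1 \<le> n" using n by (metis One_nat_def Suc_leI UNIV_not_empty card_gt_0_iff finite)
  then obtain x p where x: "inj_on x {..<n}" "\<And>j. 1 \<le> j \<Longrightarrow> j < n \<Longrightarrow> p j < j"
    "{e \<in> T. e \<subseteq> x ` {..<n}} = {{x j, x (p j)} | j. 1 \<le> j \<and> j < n}"
    using tree_growth[OF T, of n] n by auto
  have "x ` {..<n} = UNIV"
    by (rule card_subset_eq) (use x(1) n in \<open>simp_all add: card_image\<close>)
  then show ?thesis using x by (intro that[of x p]) (auto simp: bij_betw_def)
qed

lemma tree_no_triangle:
  assumes T: "is_tree T" and "a \<noteq> b" "b \<noteq> c" "a \<noteq> c" "{a, b} \<in> T" "{b, c} \<in> T" "{a, c} \<in> T"
  shows False
proof -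
  have "graph_cycle T [a, b, c]"
    unfolding graph_cycle_def
  proof (intro conjI allI impI)
    fix j assume "j < length [a, b, c]"
    then consider "j = 0" | "j = 1" | "j = 2" by fastforce
    then show "{[a, b, c] ! j, [a, b, c] ! (Suc j mod length [a, b, c])} \<in> T"
      by cases (use assms(5-7) in \<open>simp_all add: insert_commute\<close>)
  qed (use assms(2-4) in simp_all)
  then show False using T by (auto simp: is_tree_def)
qed

lemma cover_set_complement_graph:
  "cover_set (complement_graph T) C \<longleftrightarrow> (\<forall>i j. i \<notin> C \<longrightarrow> j \<notin> C \<longrightarrow> i \<noteq> j \<longrightarrow> {i, j} \<in> T)"
  by (auto simp: cover_set_def complement_graph_def)

text \<open>The complement of a cover set of \<open>T\<^sup>c\<close> is a clique of \<open>T\<close>, so minimal cover sets are the complements of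
  maximal cliques. A tree has no triangles, and no isolated vertex if it has at least two vertices,
  so its maximal cliques are its edges.\<close>

lemma minimal_cover_set_complement_tree:
  fixes T :: "'v::finite graph"
  assumes T: "is_tree T" and n: "card (UNIV :: 'v set) \<ge> 2"
  shows "minimal_cover_set (complement_graph T) C \<longleftrightarrow> (\<exists>e\<in>T. C = UNIV - e)"
proof
  assume C: "minimal_cover_set (complement_graph T) C"
  then have clique: "{i, j} \<in> T" if "i \<notin> C" "j \<notin> C" "i \<noteq> j" for i j
    using that unfolding minimal_cover_set_def cover_set_complement_graph by blast
  have min: "\<exists>i j. i \<notin> C - {l} \<and> j \<notin> C - {l} \<and> i \<noteq> j \<and> {i, j} \<notin> T" if "l \<in> C" for l
    using C that unfolding minimal_cover_set_def cover_set_complement_graph by blast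
  obtain a where a: "a \<notin> C"
  proof (rule ccontr)
    assume "\<not> thesis"
    then have "C = UNIV" using that by blast
    then show False using min[of undefined] by auto
  qed
  obtain b where b: "b \<notin> C" "b \<noteq> a"
  proof (rule ccontr)
    assume "\<not> thesis"
    then have out: "\<And>i. i \<notin> C \<Longrightarrow> i = a" using that by blast
    have "{a} \<noteq> UNIV" using n by (metis card_1_singleton_iff One_nat_def not_less_eq_eq numeral_2_eq_2 le_refl)
    then obtain b where b: "b \<noteq> a" "{a, b} \<in> T"
      using connected_boundary_edge[of T a "{a}"] T by (auto simp: is_tree_def)
    then have "b \<in> C" using out by blast
    from min[OF this] obtain i j where ij: "i \<notin> C - {b}" "j \<notin> C - {b}" "i \<noteq> j" "{i, j} \<notin> T" by blast
    then have "i = a \<or> i = b" "j = a \<or> j = b" using out by blast+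
    then show False using ij b by (auto simp: insert_commute)
  qed
  have "c = a \<or> c = b" if "c \<notin> C" for c
    using tree_no_triangle[OF T, of a b c] clique a b that by metis
  then have "C = UNIV - {a, b}" using a b by auto
  then show "\<exists>e\<in>T. C = UNIV - e" using clique[of a b] a b by blast
next
  assume "\<exists>e\<in>T. C = UNIV - e"
  then obtain e where e: "e \<in> T" "C = UNIV - e" by blast
  then have "card e = 2" using T by (simp add: is_tree_def simple_graph_def)
  then obtain a b where ab: "e = {a, b}" "a \<noteq> b" by (auto simp: card_2_iff)
  show "minimal_cover_set (complement_graph T) C"
    unfolding minimal_cover_set_def cover_set_complement_graph
  proof (intro conjI ballI notI)
    show "\<forall>i j. i \<notin> C \<longrightarrow> j \<notin> C \<longrightarrow> i \<noteq> j \<longrightarrow> {i, j} \<in> T" using e ab by (auto simp: insert_commute)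
    fix l assume l: "l \<in> C" and all: "\<forall>i j. i \<notin> C - {l} \<longrightarrow> j \<notin> C - {l} \<longrightarrow> i \<noteq> j \<longrightarrow> {i, j} \<in> T"
    then show False using tree_no_triangle[OF T, of a b l] e ab by auto
  qed
qed

section \<open>The Betti numbers\<close>

theorem theorem4p4:
  fixes T G :: "'v::finite graph"
    and J :: "('v, 'k::field) mpoly set"
    and n s i :: nat
  assumes "card (UNIV :: 'v set) = n"
    and "n \<ge> 2"
    and "is_tree T"
    and "G = complement_graph T"
    and "J = cover_ideal G"
    and "s \<ge> 1"
  shows "betti (ideal_power J s) i = (n - 2 choose i) * (n - 2 - i + s choose (n - 2))"
proof -
  obtain x p where x: "bij_betw x {..<n} (UNIV :: 'v set)" and p: "\<And>j. 1 \<le> j \<Longrightarrow> j < n \<Longrightarrow> p j < j"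
    and T: "T = {{x j, x (p j)} | j. 1 \<le> j \<and> j < n}"
    by (rule tree_leaf_order[OF assms(3,1)]) (rule that)
  interpret tree: tree_order n s x p
    by unfold_locales (use x p assms(2,6) in auto)
  have "minimal_cover_set G C \<longleftrightarrow> (\<exists>e\<in>T. C = UNIV - e)" for C
    unfolding assms(4) by (rule minimal_cover_set_complement_tree) (use assms(1-3) in simp_all)
  moreover have "T = (\<lambda>j. {x j, x (p j)}) ` {1..<n}"
    unfolding T by auto
  ultimately have "minimal_cover_set G C \<longleftrightarrow> (\<exists>j\<in>{1..<n}. C = UNIV - {x j, x (p j)})" for C
    by simp
  then have "{(\<Prod>v\<in>C. Var v) | C. minimal_cover_set G C} = (tree.gen ` {1..<n} :: ('v, 'k) mpoly set)"
    by (auto simp: tree.gen_def image_iff)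
  then have "J = ideal_gen (tree.gen ` {1..<n})"
    by (simp only: assms(5) cover_ideal_def)
  then show ?thesis by (simp only: tree.betti_ideal_power)
qed

end
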